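(* Let $\alpha$ be a positive irrational number and let $c=h/k\in(0,1)$ with $h,k$ coprime positive integers. Let $(a_n)_{n\ge 0}$ be the partial quotients of $\alpha$ and $(p_n/q_n)_{n\ge -2}$ its convergents. Then the following three statements are equivalent: (1) $\sup_n D_n(\alpha,c)<+\infty$; (2) there exists an even integer $m\ge -1$ such that $k\mid q_{m+2n}$ for all $n\ge 0$; (3) there exists an even integer $m\ge -1$ such that the tuple $(a_0,a_1,\dots,a_m)$ is of type-$k$ and $k\mid a_{m+2n}$ for all $n\ge 1$. Likewise, the following three statements are equivalent: (1') $\inf_n D_n(\alpha,c)>-\infty$; (2') there exists an odd integer $m\ge -1$ such that $k\mid q_{m+2n}$ for all $n\ge 0$; (3') there exists an odd integer $m\ge -1$ such that the tuple $(a_0,a_1,\dots,a_m)$ is of type-$k$ and $k\mid a_{m+2n}$ for all $n\ge 1$.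
   Context: For $n\ge 0$, $D_n(\alpha,c)=\sum_{j=1}^n 1_{[0,c)}(\{j\alpha\})-cn$, where $\{\cdot\}$ is the fractional part. Continued fractions: $\alpha=[a_0;a_1a_2a_3\cdots]$ with $a_0\ge 0$ and $a_n\ge 1$ integers for $n\ge1$; $p_{-2}=0,\ p_{-1}=1,\ q_{-2}=1,\ q_{-1}=0$ and $p_n=a_np_{n-1}+p_{n-2}$, $q_n=a_nq_{n-1}+q_{n-2}$ for $n\ge 0$. Type-$k$: for an integer $N$, $\pi(N)\in\{0,1,\dots,k-1\}$ denotes its residue modulo $k$. For a tuple $M=(a_0,\dots,a_m)$ of non-negative integers, $m\ge -1$ (the case $m=-1$ is the empty tuple), define $q^M_{-2}=1$, $q^M_{-1}=0$, $q^M_n=a_nq^M_{n-1}+q^M_{n-2}$ for $0\le n\le m$. The character of $M$ is $\kappa(M)=(\pi(q^M_{m-1}),\pi(q^M_m))$. The tuple $M$ is of type-$k$ if $\kappa(M)=(j,0)$ for some $j\in\{1,\dots,k-1\}$. In particular the empty tuple has character $(1,0)$ and is of type-$k$. *)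

theory Defs
  imports Complex_Main "HOL-Library.Extended_Real" "HOL-Library.Indicator_Function"
begin

definition discrepancy :: "nat \<Rightarrow> real \<Rightarrow> real \<Rightarrow> real" where
  "discrepancy n \<alpha> c = (\<Sum>j = 1..n. indicat_real {0..<c} (frac (real j * \<alpha>))) - c * real n"

subsection \<open>Continued fractions\<close>

primrec complete_quotient :: "real \<Rightarrow> nat \<Rightarrow> real" where
  "complete_quotient \<alpha> 0 = \<alpha>"
| "complete_quotient \<alpha> (Suc n) = 1 / frac (complete_quotient \<alpha> n)"

text \<open>The conversion to natural numbers does not truncate for the positive numbers
  considered here; that these are the partial quotients of \<open>\<alpha>\<close>, in the sense that the
  convergents tend to \<open>\<alpha>\<close>, is \<open>convergents_tendsto\<close> below.\<close>

definition partial_quotient :: "real \<Rightarrow> nat \<Rightarrow> nat" where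
  "partial_quotient \<alpha> n = nat \<lfloor>complete_quotient \<alpha> n\<rfloor>"

text \<open>Numerators and denominators are indexed from \<open>-2\<close>; the values at indices
  below \<open>-2\<close> are irrelevant.\<close>

function cf_num :: "(nat \<Rightarrow> nat) \<Rightarrow> int \<Rightarrow> nat" where
  "cf_num a n = (if n \<le> - 2 then 0 else if n = - 1 then 1
                 else a (nat n) * cf_num a (n - 1) + cf_num a (n - 2))"
  by pat_completeness auto
termination by (relation "measure (\<lambda>(a, n). nat (n + 2))") auto

function cf_den :: "(nat \<Rightarrow> nat) \<Rightarrow> int \<Rightarrow> nat" where
  "cf_den a n = (if n \<le> - 2 then 1 else if n = - 1 then 0
                 else a (nat n) * cf_den a (n - 1) + cf_den a (n - 2))"
  by pat_completeness auto
termination by (relation "measure (\<lambda>(a, n). nat (n + 2))") auto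

declare cf_num.simps [simp del] cf_den.simps [simp del]

subsection \<open>Tuples of type \<open>k\<close>\<close>

text \<open>A tuple \<open>(a\<^sub>0, \<dots>, a\<^sub>m)\<close> is a list \<open>M\<close> of length \<open>m + 1\<close>. The character only involves
  denominators of index at most \<open>m\<close>, so no entry beyond the end of \<open>M\<close> is accessed.\<close>

definition character :: "nat \<Rightarrow> nat list \<Rightarrow> nat \<times> nat" where
  "character k M = (let m = int (length M) - 1 in
     (cf_den ((!) M) (m - 1) mod k, cf_den ((!) M) m mod k))"

definition of_type :: "nat \<Rightarrow> nat list \<Rightarrow> bool" where
  "of_type k M \<longleftrightarrow> (\<exists>j\<in>{1..k - 1}. character k M = (j, 0))"

subsection \<open>Basic facts\<close>

lemma cf_num_simps [simp]:
  "cf_num a (- 2) = 0" "cf_num a (- 1) = 1"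
  "n \<ge> 0 \<Longrightarrow> cf_num a n = a (nat n) * cf_num a (n - 1) + cf_num a (n - 2)"
  by (subst cf_num.simps; simp)+

lemma cf_den_simps [simp]:
  "cf_den a (- 2) = 1" "cf_den a (- 1) = 0"
  "n \<ge> 0 \<Longrightarrow> cf_den a n = a (nat n) * cf_den a (n - 1) + cf_den a (n - 2)"
  by (subst cf_den.simps; simp)+

declare cf_num_simps(3) [simp del] cf_den_simps(3) [simp del]

lemma character_Nil: "k \<ge> 2 \<Longrightarrow> character k [] = (1, 0)"
  by (simp add: character_def)

lemma of_type_Nil: "k \<ge> 2 \<Longrightarrow> of_type k []"
  by (auto simp: of_type_def character_Nil)

lemma complete_quotient_irrational:
  assumes "\<alpha> \<notin> \<rat>"
  shows "complete_quotient \<alpha> n \<notin> \<rat>"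
proof (induction n)
  case 0
  then show ?case using assms by simp
next
  case (Suc n)
  let ?x = "complete_quotient \<alpha> n"
  show ?case
  proof
    assume "complete_quotient \<alpha> (Suc n) \<in> \<rat>"
    then have "inverse (1 / frac ?x) \<in> \<rat>" by (simp only: complete_quotient.simps Rats_inverse)
    then have "frac ?x + of_int \<lfloor>?x\<rfloor> \<in> \<rat>" by (intro Rats_add) simp_all
    then show False using Suc by (simp add: frac_def)
  qed
qed

lemma frac_complete_quotient_pos:
  assumes "\<alpha> \<notin> \<rat>"
  shows "frac (complete_quotient \<alpha> n) > 0"
  using complete_quotient_irrational[OF assms, of n] Ints_subset_Rats
  by (auto simp: frac_gt_0_iff)

lemma complete_quotient_gt_1:
  assumes "\<alpha> \<notin> \<rat>"
  shows "complete_quotient \<alpha> (Suc n) > 1"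
  using frac_complete_quotient_pos[OF assms, of n] frac_lt_1[of "complete_quotient \<alpha> n"] by simp

lemma partial_quotient_ge_1:
  assumes "\<alpha> \<notin> \<rat>"
  shows "partial_quotient \<alpha> (Suc n) \<ge> 1"
  using complete_quotient_gt_1[OF assms, of n] unfolding partial_quotient_def by linarith

lemma complete_quotient_step:
  assumes "\<alpha> > 0" "\<alpha> \<notin> \<rat>"
  shows "complete_quotient \<alpha> n =
    real (partial_quotient \<alpha> n) + 1 / complete_quotient \<alpha> (Suc n)"
proof -
  have "complete_quotient \<alpha> n > 0"
  proof (cases n)
    case 0
    then show ?thesis using assms by simp
  next
    case (Suc m)
    then show ?thesis unfolding Suc using complete_quotient_gt_1[OF assms(2), of m] by linarith
  qed
  then have "real (partial_quotient \<alpha> n) = of_int \<lfloor>complete_quotient \<alpha> n\<rfloor>"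
    by (simp add: partial_quotient_def)
  then show ?thesis by (simp add: frac_def)
qed

lemma cf_complete_quotient:
  fixes \<alpha> :: real
  assumes "\<alpha> > 0" "\<alpha> \<notin> \<rat>"
  defines "a \<equiv> partial_quotient \<alpha>"
  shows "\<alpha> * (complete_quotient \<alpha> n * cf_den a (int n - 1) + cf_den a (int n - 2)) =
    complete_quotient \<alpha> n * cf_num a (int n - 1) + cf_num a (int n - 2)"
proof (induction n)
  case 0
  then show ?case by simp
next
  case (Suc n)
  let ?X = "complete_quotient \<alpha> (Suc n)"
  have X: "?X > 1" using complete_quotient_gt_1 assms by blast
  have e: "complete_quotient \<alpha> n = a n + 1 / ?X"
    using complete_quotient_step assms by simp
  have "?X * (\<alpha> * ((a n + 1 / ?X) * cf_den a (int n - 1) + cf_den a (int n - 2))) =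
    ?X * ((a n + 1 / ?X) * cf_num a (int n - 1) + cf_num a (int n - 2))"
    using Suc unfolding e by simp
  then have "\<alpha> * (?X * (a n * cf_den a (int n - 1) + cf_den a (int n - 2)) + cf_den a (int n - 1)) =
    ?X * (a n * cf_num a (int n - 1) + cf_num a (int n - 2)) + cf_num a (int n - 1)"
  proof -
    have *: "?X * ((a n + 1 / ?X) * r + s) = ?X * (a n * r + s) + r" for r s
      using X by (simp add: field_simps del: complete_quotient.simps)
    show ?thesis
      using \<open>?X * (\<alpha> * _) = _\<close> unfolding mult.left_commute[of ?X \<alpha>] * .
  qed
  then show ?case
    by (simp add: cf_den_simps(3)[of "int n"] cf_num_simps(3)[of "int n"] del: complete_quotient.simps)
qed

lemma cf_determinant:
  "real (cf_num a (int n - 1)) * cf_den a (int n - 2) -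
    real (cf_num a (int n - 2)) * cf_den a (int n - 1) = (- 1) ^ n"
proof (induction n)
  case 0
  then show ?case by simp
next
  case (Suc n)
  then show ?case
    by (simp add: cf_den_simps(3)[of "int n"] cf_num_simps(3)[of "int n"] algebra_simps)
qed

lemma cf_den_ge:
  assumes "\<And>n. a (Suc n) \<ge> 1"
  shows "cf_den a (int n) \<ge> max 1 n"
proof (induction n rule: less_induct)
  case (less n)
  consider "n = 0" | "n = 1" | m where "n = Suc (Suc m)" by (metis One_nat_def not0_implies_Suc)
  then show ?case
  proof cases
    case 1
    then show ?thesis by (simp add: cf_den_simps(3))
  next
    case 2
    then show ?thesis using assms[of 0] by (simp add: cf_den_simps(3))
  next
    case 3
    have "cf_den a (int n) = a n * cf_den a (int (Suc m)) + cf_den a (int m)"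
    proof -
      have "int n - 1 = int (Suc m)" "int n - 2 = int m" using 3 by auto
      then show ?thesis using cf_den_simps(3)[of "int n" a] by (simp only: of_nat_0_le_iff nat_int)
    qed
    moreover have "cf_den a (int (Suc m)) \<ge> max 1 (Suc m)" "cf_den a (int m) \<ge> max 1 m"
      by (rule less, simp add: 3)+
    moreover have "a n * cf_den a (int (Suc m)) \<ge> 1 * cf_den a (int (Suc m))"
      using assms[of "Suc m"] 3 by (intro mult_right_mono) auto
    ultimately show ?thesis using 3 by linarith
  qed
qed

theorem convergents_tendsto:
  fixes \<alpha> :: real
  assumes "\<alpha> > 0" "\<alpha> \<notin> \<rat>"
  defines "a \<equiv> partial_quotient \<alpha>"
  shows "(\<lambda>n. real (cf_num a (int n)) / real (cf_den a (int n))) \<longlonglongrightarrow> \<alpha>"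
proof -
  have le: "\<bar>real (cf_num a (int n)) / real (cf_den a (int n)) - \<alpha>\<bar> \<le> 1 / real n"
    if "n \<ge> 1" for n
  proof -
    define X p q p' q' where "X = complete_quotient \<alpha> (Suc n)"
      and "p = real (cf_num a (int n))" and "q = real (cf_den a (int n))"
      and "p' = real (cf_num a (int n - 1))" and "q' = real (cf_den a (int n - 1))"
    have X: "X > 1" using complete_quotient_gt_1 assms by (simp only: X_def)
    have q: "q \<ge> real n" "q \<ge> 1"
      using cf_den_ge[of a n] partial_quotient_ge_1[OF assms(2)] by (auto simp: a_def q_def)
    have i: "\<alpha> * (X * q + q') = X * p + p'"
      using cf_complete_quotient[OF assms(1,2), of "Suc n"]
      by (simp add: X_def p_def q_def p'_def q'_def a_def del: complete_quotient.simps)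
    have d: "p * q' - p' * q = (- 1) ^ Suc n"
      using cf_determinant[of a "Suc n"] by (simp add: p_def q_def p'_def q'_def)
    have "(p - \<alpha> * q) * (X * q + q') = p * (X * q + q') - q * (X * p + p')"
      unfolding i[symmetric] by (simp add: algebra_simps)
    also have "\<dots> = (- 1) ^ Suc n" unfolding d[symmetric] by (simp add: algebra_simps)
    finally have "\<bar>p - \<alpha> * q\<bar> * \<bar>X * q + q'\<bar> = 1" by (simp flip: abs_mult)
    moreover have "X * q \<ge> 1 * 1" using X q by (intro mult_mono) auto
    then have "\<bar>X * q + q'\<bar> \<ge> 1" by (simp add: q'_def)
    ultimately have "\<bar>p - \<alpha> * q\<bar> \<le> 1"
      by (metis abs_ge_zero mult.right_neutral mult_left_mono)
    moreover have "p / q - \<alpha> = (p - \<alpha> * q) / q" using q by (simp add: field_simps)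
    ultimately have "\<bar>p / q - \<alpha>\<bar> \<le> 1 / q" using q by (simp add: divide_right_mono)
    also have "\<dots> \<le> 1 / real n" using q that by (simp add: frac_le)
    finally show ?thesis by (simp add: p_def q_def)
  qed
  have "(\<lambda>n. real (cf_num a (int n)) / real (cf_den a (int n)) - \<alpha>) \<longlonglongrightarrow> 0"
  proof (rule tendsto_rabs_zero_cancel, rule tendsto_sandwich[OF _ _ tendsto_const lim_1_over_n])
    show "\<forall>\<^sub>F n in sequentially.
        \<bar>real (cf_num a (int n)) / real (cf_den a (int n)) - \<alpha>\<bar> \<le> 1 / real n"
      using le by (rule eventually_sequentiallyI)
  qed simp
  then show ?thesis by (rule LIM_zero_cancel)
qed

end

theory Submission
  imports Defs
begin

text \<open>
  Since \<open>D\<^sub>n(-\<alpha>, 1 - c) = -D\<^sub>n(\<alpha>, c)\<close>, both halves follow from one criterion for lower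
  boundedness, in which the convergents with \<open>q \<beta> < p\<close> are those of even index. Write
  \<open>d\<^sub>n = \<bar>q\<^sub>n \<beta> - p\<^sub>n\<bar>\<close>.

  If \<open>k\<close> divides \<open>q\<^sub>n\<close> for all large even \<open>n\<close>, choose \<open>t\<close> with \<open>t p\<^sub>n \<equiv> h\<close> modulo \<open>k\<close>; it does not
  depend on \<open>n\<close>. In an Ostrowski-type decomposition of an orbit, a block of length \<open>q\<^sub>n\<close>
  started at \<open>x\<close> loses at most \<open>1\<close>, and only if \<open>x \<ge> t d\<^sub>n / k\<close>. Since \<open>k\<close> divides the partial
  quotient in between, the preceding blocks of length \<open>q\<^sub>n\<^sub>+\<^sub>1\<close> gain \<open>1\<close> if they lead from below
  \<open>t d\<^sub>n\<^sub>+\<^sub>2 / k\<close> to such an \<open>x\<close>, so that the losses do not accumulate.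

  Conversely, discrepancies lie in \<open>(1/k) \<int>\<close>, and they add up along denominators of rapidly
  increasing index. Lower boundedness therefore forces the discrepancy at \<open>q\<^sub>n\<close> to be nonnegative
  for large \<open>n\<close>. For even \<open>n\<close> with \<open>k\<close> not dividing \<open>q\<^sub>n\<close>, this implies that the residue of
  \<open>-h q\<close> modulo \<open>k\<close> is strictly larger at \<open>n + 1\<close> than at \<open>n - 1\<close>, and for the other large even \<open>n\<close>
  the two residues agree. As these residues are less than \<open>k\<close>, only finitely many even \<open>n\<close> are of
  the first kind.
\<close>

subsection \<open>Discrepancies with a shifted starting point\<close>

text \<open>The starting point is a parameter because cutting an orbit into blocks makes each block
  start where the previous one ends.\<close>

definition shifted_discrepancy :: "real \<Rightarrow> nat \<Rightarrow> real \<Rightarrow> real \<Rightarrow> real" where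
  "shifted_discrepancy x n \<beta> c = (\<Sum>j = 1..n. indicat_real {0..<c} (frac (x + real j * \<beta>))) - c * real n"

lemma discrepancy_eq_shifted: "discrepancy n \<beta> c = shifted_discrepancy 0 n \<beta> c"
  by (simp add: discrepancy_def shifted_discrepancy_def)

lemma shifted_discrepancy_0 [simp]: "shifted_discrepancy x 0 \<beta> c = 0"
  by (simp add: shifted_discrepancy_def)

lemma shifted_discrepancy_card:
  "shifted_discrepancy x n \<beta> c = real (card {j \<in> {1..n}. frac (x + real j * \<beta>) < c}) - c * real n"
proof -
  have "(\<Sum>j = 1..n. indicat_real {0..<c} (frac (x + real j * \<beta>))) =
    (\<Sum>j = 1..n. if frac (x + real j * \<beta>) < c then 1 else 0)"
    by (intro sum.cong) (auto simp: indicator_def)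
  also have "\<dots> = real (card {j \<in> {1..n}. frac (x + real j * \<beta>) < c})"
    by (subst sum.inter_filter[symmetric]) auto
  finally show ?thesis
    by (simp add: shifted_discrepancy_def)
qed

lemma shifted_discrepancy_add:
  "shifted_discrepancy x (m + n) \<beta> c =
    shifted_discrepancy x m \<beta> c + shifted_discrepancy (x + real m * \<beta>) n \<beta> c"
proof -
  have "(\<Sum>j = 1..m + n. g j) = (\<Sum>j = 1..m. g j) + (\<Sum>j = 1..n. g (m + j))" for g :: "nat \<Rightarrow> real"
    by (induction n) auto
  then show ?thesis
    by (simp add: shifted_discrepancy_def algebra_simps)
qed

lemma shifted_discrepancy_int_shift:
  "shifted_discrepancy (x + of_int z) n \<beta> c = shifted_discrepancy x n \<beta> c"
proof -
  have "frac (x + of_int z + y) = frac (x + y)" for y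
    using frac_add_of_int_right[of "x + y" z] by (simp only: ac_simps)
  then show ?thesis by (simp add: shifted_discrepancy_def)
qed

text \<open>Modulo 1 the first \<open>m\<close> steps amount to a translation by \<open>l\<close>,
  so only \<open>l\<close> is carried over to the next block. In the applications \<open>m\<close>
  is a convergent denominator and \<open>l\<close> its signed error.\<close>

lemma shifted_discrepancy_block:
  assumes "real m * \<beta> = of_int z + l"
  shows "shifted_discrepancy x (m + n) \<beta> c =
    shifted_discrepancy x m \<beta> c + shifted_discrepancy (x + l) n \<beta> c"
proof -
  have "x + real m * \<beta> = x + l + of_int z" using assms by simp
  then show ?thesis
    by (simp only: shifted_discrepancy_add shifted_discrepancy_int_shift)
qed

lemma shifted_discrepancy_blocks:
  assumes "real m * \<beta> = of_int z + l"
  shows "shifted_discrepancy x (b * m) \<beta> c = (\<Sum>s<b. shifted_discrepancy (x + real s * l) m \<beta> c)"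
proof (induction b)
  case 0
  then show ?case by simp
next
  case (Suc b)
  have "real (b * m) * \<beta> = of_int (int b * z) + real b * l"
    using arg_cong[OF assms, of "(*) (real b)"] by (simp add: algebra_simps)
  from shifted_discrepancy_block[OF this, of x m c] Suc show ?case
    by (simp add: add.commute)
qed

lemma shifted_discrepancy_blocks_add:
  assumes "real m * \<beta> = of_int z + l"
  shows "shifted_discrepancy x (b * m + n) \<beta> c =
    shifted_discrepancy x (b * m) \<beta> c + shifted_discrepancy (x + real b * l) n \<beta> c"
proof (rule shifted_discrepancy_block)
  show "real (b * m) * \<beta> = of_int (int b * z) + real b * l"
    using arg_cong[OF assms, of "(*) (real b)"] by (simp add: algebra_simps)
qed

lemma shifted_discrepancy_ge:
  assumes "0 \<le> c" "c \<le> 1"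
  shows "shifted_discrepancy x n \<beta> c \<ge> - real n"
proof -
  have "c * real n \<le> 1 * real n" using assms by (intro mult_right_mono) auto
  then show ?thesis unfolding shifted_discrepancy_card by linarith
qed

section \<open>Counting orbit points through residues modulo a denominator\<close>

lemma frac_eqI:
  fixes x y :: real
  assumes "x = of_int z + y" "0 \<le> y" "y < 1"
  shows "frac x = y"
  using assms(2,3) unfolding assms(1) frac_unique_iff by simp

lemma bij_betw_residues:
  fixes p :: int and q :: nat
  assumes "coprime p (int q)" "q \<ge> 1"
  shows "bij_betw (\<lambda>j. int j * p mod int q) {1..q} {0..<int q}"
proof -
  have inj: "inj_on (\<lambda>j. int j * p mod int q) {1..q}"
  proof (rule inj_onI)
    fix i j assume ij: "i \<in> {1..q}" "j \<in> {1..q}" and "int i * p mod int q = int j * p mod int q"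
    then have "int q dvd (int i - int j) * p"
      by (simp add: mod_eq_dvd_iff left_diff_distrib)
    then have "int q dvd int i - int j"
      using assms(1) by (simp add: coprime_commute coprime_dvd_mult_left_iff)
    moreover have "\<bar>int i - int j\<bar> < int q" using ij by auto
    ultimately have "int i - int j = 0"
      using dvd_imp_le_int[of "int i - int j" "int q"] by linarith
    then show "i = j" by simp
  qed
  have "(\<lambda>j. int j * p mod int q) ` {1..q} = {0..<int q}"
  proof (rule card_subset_eq)
    show "card ((\<lambda>j. int j * p mod int q) ` {1..q}) = card {0..<int q}"
      using card_image[OF inj] by simp
  qed (use assms in auto)
  with inj show ?thesis by (simp add: bij_betw_def)
qed

lemma card_residues:
  fixes p :: int and q :: nat
  assumes "coprime p (int q)" "q \<ge> 1" "J \<subseteq> {0..<int q}"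
  shows "card {j \<in> {1..q}. int j * p mod int q \<in> J} = card J"
proof -
  let ?r = "\<lambda>j. int j * p mod int q"
  note b = bij_betw_residues[OF assms(1,2)]
  have "bij_betw ?r {j \<in> {1..q}. ?r j \<in> J} J"
    unfolding bij_betw_def
  proof
    show "inj_on ?r {j \<in> {1..q}. ?r j \<in> J}"
      using b by (auto simp: bij_betw_def intro: inj_on_subset)
    have "?r ` {j \<in> {1..q}. ?r j \<in> J} = ?r ` {1..q} \<inter> J" by blast
    also have "\<dots> = J" using b assms(3) by (simp only: bij_betw_imp_surj_on Int_absorb1)
    finally show "?r ` {j \<in> {1..q}. ?r j \<in> J} = J" .
  qed
  then show ?thesis by (rule bij_betw_same_card)
qed

text \<open>Over one period the multiples of \<open>p\<close> meet every residue modulo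
  \<open>q\<close> exactly once, so a set of residues whose indices provably land in [0, c) is
  counted by its own cardinality.\<close>

lemma shifted_discrepancy_ge_card:
  fixes p :: int and q :: nat
  assumes "coprime p (int q)" "q \<ge> 1" "J \<subseteq> {0..<int q}"
    and "\<And>j. j \<in> {1..q} \<Longrightarrow> int j * p mod int q \<in> J \<Longrightarrow> frac (x + real j * \<beta>) < c"
  shows "shifted_discrepancy x q \<beta> c \<ge> real (card J) - c * real q"
proof -
  have "card J \<le> card {j \<in> {1..q}. frac (x + real j * \<beta>) < c}"
    unfolding card_residues[OF assms(1-3), symmetric] using assms(4) by (intro card_mono) auto
  then show ?thesis by (simp add: shifted_discrepancy_card)
qed

lemma shifted_discrepancy_le_card:
  fixes p :: int and q :: nat
  assumes "coprime p (int q)" "q \<ge> 1" "J \<subseteq> {0..<int q}"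
    and "\<And>j. j \<in> {1..q} \<Longrightarrow> frac (x + real j * \<beta>) < c \<Longrightarrow> int j * p mod int q \<in> J"
  shows "shifted_discrepancy x q \<beta> c \<le> real (card J) - c * real q"
proof -
  have "card {j \<in> {1..q}. frac (x + real j * \<beta>) < c} \<le> card J"
    unfolding card_residues[OF assms(1-3), symmetric] using assms(4) by (intro card_mono) auto
  then show ?thesis by (simp add: shifted_discrepancy_card)
qed

text \<open>An orbit point is an integer plus a point of the rational rotation by p / q plus a
  perturbation. The block estimates bound the perturbation by 1 / q.\<close>

lemma block_point:
  fixes p :: int and q j :: nat and \<beta> x :: real
  assumes "q \<ge> 1"
  shows "x + real j * \<beta> = of_int (int j * p div int q) +
    (of_int (int j * p mod int q) / real q + (x + real j * (real q * \<beta> - of_int p) / real q))"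
proof -
  have "int j * p = int q * (int j * p div int q) + int j * p mod int q" by simp
  from arg_cong[OF this, of real_of_int]
  have "real j * of_int p = real q * of_int (int j * p div int q) + of_int (int j * p mod int q)"
    by (simp only: of_int_add of_int_mult of_int_of_nat_eq)
  then show ?thesis using assms by (simp add: field_simps)
qed

subsection \<open>Blocks of convergent length\<close>

text \<open>The abstract form covers both the convergents of \<alpha> from index 1 on and, with
  negated numerators, those of - \<alpha> from index 0 on. \<open>a n\<close> is the multiplier
  leading to index n + 2, and \<open>sign\<close> says that q \<beta> < p holds at the even
  indices.\<close>

locale convergent_sequence =
  fixes \<beta> :: real and a q :: "nat \<Rightarrow> nat" and p :: "nat \<Rightarrow> int"
  assumes irrational: "\<beta> \<notin> \<rat>"
    and a_pos: "\<And>n. a n \<ge> 1"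
    and q_pos: "\<And>n. q n \<ge> 1"
    and q_rec: "\<And>n. q (Suc (Suc n)) = a n * q (Suc n) + q n"
    and p_rec: "\<And>n. p (Suc (Suc n)) = int (a n) * p (Suc n) + p n"
    and det: "\<And>n. p n * int (q (Suc n)) - p (Suc n) * int (q n) = (- 1) ^ n"
    and sign: "\<And>n. (- 1) ^ n * (real (q n) * \<beta> - of_int (p n)) < 0"
begin

definition d :: "nat \<Rightarrow> real" where
  "d n = \<bar>real (q n) * \<beta> - of_int (p n)\<bar>"

lemma d_eq: "d n = - ((- 1) ^ n * (real (q n) * \<beta> - of_int (p n)))"
  using sign[of n] unfolding d_def by (cases "even n") auto

lemma d_pos: "d n > 0"
  using sign[of n] unfolding d_eq by linarith

lemma q_beta: "real (q n) * \<beta> = of_int (p n) - (- 1) ^ n * d n"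
  unfolding d_eq by (cases "even n") auto

lemma q_beta_even: "even n \<Longrightarrow> real (q n) * \<beta> = of_int (p n) + (- d n)"
  and q_beta_odd: "odd n \<Longrightarrow> real (q n) * \<beta> = of_int (p n) + d n"
  by (simp_all add: q_beta)

lemma d_rec: "d n = real (a n) * d (Suc n) + d (Suc (Suc n))"
  unfolding d_eq by (simp add: q_rec p_rec algebra_simps)

text \<open>Expressing \<open>p\<close> through \<open>d\<close> in \<open>det\<close> cancels the
  terms with \<beta>, and the alternating signs turn the difference into a sum.\<close>

lemma det_d: "real (q (Suc n)) * d n + real (q n) * d (Suc n) = 1"
proof -
  have "real_of_int (p n * int (q (Suc n)) - p (Suc n) * int (q n)) = (- 1) ^ n"
    unfolding det by simp
  then have *: "of_int (p n) * real (q (Suc n)) - of_int (p (Suc n)) * real (q n) = (- 1) ^ n"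
    by simp
  have "real (q (Suc n)) * d n + real (q n) * d (Suc n) =
    (- 1) ^ n * (of_int (p n) * real (q (Suc n)) - of_int (p (Suc n)) * real (q n))"
    unfolding d_eq by (simp add: algebra_simps)
  also have "\<dots> = 1" unfolding * by (simp flip: power_add mult_2)
  finally show ?thesis .
qed

lemma d_mult_less: "real (q (Suc n)) * d n < 1"
proof -
  have "real (q n) * d (Suc n) > 0" using q_pos[of n] d_pos[of "Suc n"] by simp
  then show ?thesis using det_d[of n] by linarith
qed

lemma d_decreasing: "d (Suc n) < d n"
proof -
  have "1 * d (Suc n) \<le> real (a n) * d (Suc n)"
    using a_pos[of n] d_pos[of "Suc n"] by (intro mult_right_mono) auto
  then show ?thesis using d_rec[of n] d_pos[of "Suc (Suc n)"] by linarith
qed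

lemma coprime_p_q: "coprime (p n) (int (q n))"
proof (rule coprimeI)
  fix x assume "x dvd p n" "x dvd int (q n)"
  then have "x dvd p n * int (q (Suc n)) - p (Suc n) * int (q n)" by (intro dvd_diff) auto
  then have "x dvd (- 1) ^ n" unfolding det .
  then show "is_unit x" by (rule dvd_unit_imp_unit) (simp add: is_unit_power_iff)
qed

lemma coprime_q_q: "coprime (q n) (q (Suc n))"
proof -
  have "coprime (int (q n)) (int (q (Suc n)))"
  proof (rule coprimeI)
    fix x assume "x dvd int (q n)" "x dvd int (q (Suc n))"
    then have "x dvd p n * int (q (Suc n)) - p (Suc n) * int (q n)" by (intro dvd_diff) auto
    then have "x dvd (- 1) ^ n" unfolding det .
    then show "is_unit x" by (rule dvd_unit_imp_unit) (simp add: is_unit_power_iff)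
  qed
  then show ?thesis by simp
qed

lemma q_mono: "q (Suc n) < q (Suc (Suc n))"
proof -
  have "1 * q (Suc n) \<le> a n * q (Suc n)" using a_pos[of n] by (intro mult_right_mono) auto
  then show ?thesis using q_pos[of n] unfolding q_rec by linarith
qed

lemma q_ge: "n \<le> q n"
proof (induction n)
  case 0
  then show ?case by simp
next
  case (Suc n)
  then show ?case
  proof (cases n)
    case 0
    then show ?thesis using q_pos[of "Suc n"] by simp
  next
    case (Suc m)
    then show ?thesis using q_mono[of m] \<open>n \<le> q n\<close> by simp
  qed
qed

lemma d_tendsto_0: "d \<longlonglongrightarrow> 0"
proof (rule tendsto_sandwich[OF _ _ tendsto_const lim_1_over_n])
  show "\<forall>\<^sub>F n in sequentially. 0 \<le> d n" using d_pos by (simp add: less_imp_le)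
  show "\<forall>\<^sub>F n in sequentially. d n \<le> 1 / real n"
  proof (rule eventually_sequentiallyI)
    fix n :: nat assume n: "1 \<le> n"
    have "real n * d n \<le> real (q (Suc n)) * d n"
      using q_ge[of "Suc n"] d_pos[of n] by (intro mult_right_mono) auto
    also have "\<dots> < 1" by (rule d_mult_less)
    finally show "d n \<le> 1 / real n" using n by (simp add: field_simps)
  qed
qed

end

section \<open>Estimates for a single block when c = h / k\<close>

locale rational_interval = convergent_sequence +
  fixes h k :: nat and c :: real
  assumes h_pos: "h > 0" and h_less: "h < k" and coprime_h_k: "coprime h k"
    and c_eq: "c = real h / real k"
begin

abbreviation S :: "real \<Rightarrow> nat \<Rightarrow> real" where
  "S x n \<equiv> shifted_discrepancy x n \<beta> c"

lemma k_pos: "k > 0"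
  using h_less by simp

lemma c_bounds: "0 < c" "c < 1"
  using h_pos h_less by (simp_all add: c_eq)

text \<open>The hypothesis on \<open>t\<close> below says that \<open>t / k\<close> times the vector \<open>(q n, p n)\<close> lies in the
  coset of the integer lattice shifted by \<open>(0, c)\<close>.\<close>

lemma block_even:
  assumes "odd n" and "k dvd q (Suc n)" and t: "0 < t" "t < k"
    and tp: "int k dvd int t * p (Suc n) - int h"
    and x: "- d n + d (Suc n) < x" "x < d (Suc n)"
  shows "S x (q (Suc n)) \<ge> (if x < real t / real k * d (Suc n) then 0 else - 1)"
proof -
  define Q where "Q = q (Suc n)"
  obtain m where m: "Q = k * m" using assms(2) by (auto simp: Q_def)
  have Q: "Q \<ge> 1" "m \<ge> 1" using q_pos[of "Suc n"] m by (auto simp: Q_def Suc_le_eq)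
  obtain z where z: "int t * p (Suc n) - int h = int k * z" using tp by auto
  define s where "s j = x + real j * (- d (Suc n)) / real Q" for j
  have pt: "x + real j * \<beta> = of_int (int j * p (Suc n) div int Q) +
      (of_int (int j * p (Suc n) mod int Q) / real Q + s j)" for j
    using block_point[OF Q(1), of x j \<beta> "p (Suc n)"] q_beta_even[of "Suc n"] \<open>odd n\<close>
    by (simp add: s_def Q_def)
  have dn: "real Q * d n < 1" using d_mult_less[of n] by (simp add: Q_def)
  have s_bounds: "- 1 < real Q * s j" "real Q * s j < 1" if "j \<in> {1..Q}" for j
  proof -
    have e: "real Q * s j = real Q * x - real j * d (Suc n)"
      using Q by (simp add: s_def field_simps)
    have le: "real j * d (Suc n) \<le> real Q * d (Suc n)" "0 \<le> real j * d (Suc n)"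
      using that d_pos[of "Suc n"] by (auto intro!: mult_right_mono)
    have "real Q * (- d n + d (Suc n)) < real Q * x" using x(1) Q by simp
    then show "- 1 < real Q * s j" using e le dn by (simp add: algebra_simps)
    have "real Q * x < real Q * d n" using x(2) d_decreasing[of n] Q by simp
    then show "real Q * s j < 1" using e le dn by linarith
  qed
  define H where "H = h * m"
  have cQ: "c * real Q = real H" using k_pos by (simp add: c_eq m H_def)
  have hm: "1 \<le> H" "H < Q" using h_pos h_less Q m by (auto simp: Suc_le_eq H_def)
  have frac_less: "frac (x + real j * \<beta>) < c"
    if "0 \<le> r + real Q * s j" "r + real Q * s j < real H" "j \<in> {1..Q}"
      "r = of_int (int j * p (Suc n) mod int Q)" for j r
  proof -
    have "r / real Q + s j = (r + real Q * s j) / real Q" using Q by (simp add: field_simps)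
    moreover have "real H / real Q = c" using cQ Q by (simp add: field_simps)
    moreover have "(r + real Q * s j) / real Q < real H / real Q" "0 \<le> (r + real Q * s j) / real Q"
      using that Q by (simp_all only: divide_strict_right_mono of_nat_0_less_iff) auto
    ultimately have b: "0 \<le> r / real Q + s j" "r / real Q + s j < c" by simp_all
    then have "frac (x + real j * \<beta>) = r / real Q + s j"
      using pt[of j] that(4) c_bounds by (intro frac_eqI) auto
    then show ?thesis using b by simp
  qed
  \<comment> \<open>Here c Q is the integer \<open>H\<close>. A perturbation of less than 1 / Q
    keeps the residues 1, ..., H - 1 inside [0, c), which already limits the loss to 1.\<close>
  have inner: "frac (x + real j * \<beta>) < c"
    if "j \<in> {1..Q}" "int j * p (Suc n) mod int Q \<in> {1..<int H}" for j
  proof (rule frac_less[OF _ _ that(1) refl])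
    have "1 \<le> int j * p (Suc n) mod int Q" "int j * p (Suc n) mod int Q \<le> int H - 1"
      using that(2) by auto
    then have "1 \<le> real_of_int (int j * p (Suc n) mod int Q)"
      "real_of_int (int j * p (Suc n) mod int Q) \<le> real H - 1"
      by linarith+
    then show "0 \<le> real_of_int (int j * p (Suc n) mod int Q) + real Q * s j"
      "real_of_int (int j * p (Suc n) mod int Q) + real Q * s j < real H"
      using s_bounds[OF that(1)] by linarith+
  qed
  have cop: "coprime (p (Suc n)) (int Q)" using coprime_p_q[of "Suc n"] by (simp add: Q_def)
  show ?thesis
  proof (cases "x < real t / real k * d (Suc n)")
    case True
    \<comment> \<open>\<open>X\<close> is the index whose unperturbed point H / Q equals c. Since X
      / Q = t / k, its perturbation is x - (t / k) \<open>d (Suc n)\<close>, which is negative below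
      the threshold; then this point counts as well and nothing is lost.\<close>
    define X where "X = t * m"
    have X: "X \<in> {1..Q}" using t Q m by (auto simp: X_def Suc_le_eq)
    have "int X * p (Suc n) = int m * (int t * p (Suc n) - int h) + int H"
      by (simp add: X_def H_def algebra_simps)
    also have "\<dots> = z * int Q + int H" unfolding z by (simp add: m)
    finally have rX: "int X * p (Suc n) mod int Q = int H"
      using hm(2) by simp
    have "s X = x - real X / real Q * d (Suc n)" by (simp add: s_def)
    also have "real X / real Q = real t / real k" using Q k_pos by (simp add: X_def m)
    finally have "s X = x - real t / real k * d (Suc n)" .
    then have sX: "real Q * s X < 0" using True Q by (simp add: mult_less_0_iff)
    have "frac (x + real j * \<beta>) < c"
      if "j \<in> {1..Q}" "int j * p (Suc n) mod int Q \<in> {1..int H}" for j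
    proof (cases "int j * p (Suc n) mod int Q = int H")
      case True
      have "j = X"
        using inj_onD[OF bij_betw_imp_inj_on[OF bij_betw_residues[OF cop Q(1)]] _ that(1) X] rX True
        by simp
      show ?thesis
      proof (rule frac_less[OF _ _ that(1)])
        have "1 \<le> real H" using hm by linarith
        then show "0 \<le> real H + real Q * s j" using s_bounds(1)[OF that(1)] by linarith
        show "real H + real Q * s j < real H" using sX \<open>j = X\<close> by simp
      qed (simp only: True of_int_of_nat_eq)
    next
      case False
      then show ?thesis using inner that by auto
    qed
    then have "S x Q \<ge> real (card {1..int H}) - c * real Q"
      using hm by (intro shifted_discrepancy_ge_card[OF cop Q(1)]) auto
    then show ?thesis using True cQ by (simp add: Q_def)
  next
    case False
    have "S x Q \<ge> real (card {1..<int H}) - c * real Q"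
      using hm inner by (intro shifted_discrepancy_ge_card[OF cop Q(1)]) auto
    moreover have "real (card {1..<int H}) = real H - 1" using hm by simp
    ultimately show ?thesis using False cQ by (simp add: Q_def)
  qed
qed

text \<open>As k divides \<open>q n\<close>, \<open>det\<close> makes \<open>q (Suc n)\<close> an
  inverse of \<open>p n\<close> modulo k. Hence h \<open>q (Suc n)\<close> is congruent to t, and c
  \<open>q (Suc n)\<close> is an integer \<open>R\<close> plus t / k. The residues 0, ..., R - 1
  always count, and \<open>R\<close> itself counts when x is below the threshold.\<close>

lemma block_odd:
  assumes "even n" "n > 0" and "k dvd q n" and t: "0 < t" "t < k"
    and tp: "int k dvd int t * p n - int h"
    and x: "- d (Suc n) < x" "x < d n - d (Suc n)"
  shows "S x (q (Suc n)) \<ge> - real t / real k + (if x < real t / real k * d n then 1 else 0)"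
proof -
  define Q where "Q = q (Suc n)"
  obtain m where m: "q n = k * m" using assms(3) by auto
  have Q: "Q \<ge> 1" "m \<ge> 1" using q_pos[of "Suc n"] q_pos[of n] m by (auto simp: Q_def Suc_le_eq)
  obtain z where z: "int t * p n - int h = int k * z" using tp by auto
  define s where "s j = x + real j * d (Suc n) / real Q" for j
  have pt: "x + real j * \<beta> = of_int (int j * p (Suc n) div int Q) +
      (of_int (int j * p (Suc n) mod int Q) / real Q + s j)" for j
    using block_point[OF Q(1), of x j \<beta> "p (Suc n)"] q_beta_odd[of "Suc n"] \<open>even n\<close>
    by (simp add: s_def Q_def)
  have dn: "real Q * d n < 1" using d_mult_less[of n] by (simp add: Q_def)
  have e: "real Q * s j = real Q * x + real j * d (Suc n)" for j
    using Q by (simp add: s_def field_simps)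
  have s_bounds: "- 1 < real Q * s j" "real Q * s j < 1" if "j \<in> {1..Q}" for j
  proof -
    have le: "real j * d (Suc n) \<le> real Q * d (Suc n)" "0 \<le> real j * d (Suc n)"
      using that d_pos[of "Suc n"] by (auto intro!: mult_right_mono)
    have "real Q * (- d n) < real Q * x" using x(1) d_decreasing[of n] Q by (intro mult_strict_left_mono) auto
    then show "- 1 < real Q * s j" using e le dn by (simp add: algebra_simps)
    have "real Q * x < real Q * (d n - d (Suc n))" using x(2) Q by simp
    then show "real Q * s j < 1" using e[of j] le dn by (simp add: algebra_simps)
  qed
  have cop: "coprime (p (Suc n)) (int Q)" using coprime_p_q[of "Suc n"] by (simp add: Q_def)
  \<comment> \<open>Residue 0 occurs only at j = Q, where the perturbation is x +
    \<open>d (Suc n)\<close> > 0, so no point slips below an integer and reappears near 1.\<close>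
  have nonneg: "0 \<le> real_of_int (int j * p (Suc n) mod int Q) + real Q * s j" if "j \<in> {1..Q}" for j
  proof (cases "int j * p (Suc n) mod int Q = 0")
    case True
    then have "int Q dvd int j"
      using cop by (metis coprime_commute coprime_dvd_mult_left_iff mod_0_imp_dvd)
    then have "j = Q" using that by (auto dest: dvd_imp_le)
    have "0 < real Q * (x + d (Suc n))" using x(1) Q by simp
    then show ?thesis using True e[of j] \<open>j = Q\<close> by (simp add: algebra_simps)
  next
    case False
    have "0 \<le> int j * p (Suc n) mod int Q" using Q by simp
    then have "1 \<le> int j * p (Suc n) mod int Q" using False by linarith
    then have "1 \<le> real_of_int (int j * p (Suc n) mod int Q)" by linarith
    then show ?thesis using s_bounds(1)[OF that] by linarith
  qed
  define R where "R = (int h * int Q - int t) div int k"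
  have det': "p n * int Q = 1 + p (Suc n) * int (q n)"
    using det[of n] \<open>even n\<close> by (simp add: Q_def)
  have "int k * (z * int Q + int h * 0) = (int t * p n - int h) * int Q" unfolding z by simp
  also have "\<dots> = int t * (p n * int Q) - int h * int Q" by (simp add: algebra_simps)
  also have "\<dots> = int t * p (Suc n) * int (q n) - (int h * int Q - int t)"
    unfolding det' by (simp add: algebra_simps)
  finally have hQ: "int h * int Q - int t = int k * (int t * int m * p (Suc n) - z * int Q)"
    by (simp add: m algebra_simps)
  then have R: "R = int t * int m * p (Suc n) - z * int Q" using k_pos by (simp add: R_def)
  have kR: "int h * int Q - int t = int k * R" using hQ unfolding R .
  have R_nonneg: "0 \<le> R"
  proof -
    have "0 < int h * int Q" using h_pos Q by simp
    then have "- int k < int k * R" using kR t by linarith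
    then have "int k * (- 1) < int k * R" by simp
    then have "- 1 < R" using k_pos by (simp only: mult_less_cancel_left)
    then show ?thesis by simp
  qed
  have R_less: "R < int Q"
  proof -
    have "int h * int Q \<le> int k * int Q" using h_less by (intro mult_right_mono) auto
    then have "int k * R < int k * int Q" using kR t by linarith
    then show ?thesis using k_pos by (simp only: mult_less_cancel_left)
  qed
  have cQ: "c * real Q = of_int R + real t / real k"
  proof -
    have "real_of_int (int h * int Q - int t) = real_of_int (int k * R)" unfolding kR ..
    then have "real h * real Q = real k * of_int R + real t" by simp
    then show ?thesis using k_pos by (simp add: c_eq field_simps)
  qed
  have frac_less: "frac (x + real j * \<beta>) < c"
    if "r + real Q * s j < c * real Q" "j \<in> {1..Q}"
      "r = of_int (int j * p (Suc n) mod int Q)" for j r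
  proof -
    have "r / real Q + s j = (r + real Q * s j) / real Q" using Q by (simp add: field_simps)
    moreover have "0 \<le> (r + real Q * s j) / real Q"
      using nonneg[OF that(2)] that(3) by simp
    moreover have "(r + real Q * s j) / real Q < c" using that(1) Q by (simp add: field_simps)
    ultimately have b: "0 \<le> r / real Q + s j" "r / real Q + s j < c" by simp_all
    then have "frac (x + real j * \<beta>) = r / real Q + s j"
      using pt[of j] that(3) c_bounds by (intro frac_eqI) auto
    then show ?thesis using b by simp
  qed
  have inner: "frac (x + real j * \<beta>) < c"
    if "j \<in> {1..Q}" "int j * p (Suc n) mod int Q \<in> {0..<R}" for j
  proof (rule frac_less[OF _ that(1) refl])
    have "int j * p (Suc n) mod int Q \<le> R - 1" using that(2) by auto
    then have "real_of_int (int j * p (Suc n) mod int Q) \<le> of_int R - 1" by linarith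
    moreover have "0 < real t / real k" using t by simp
    ultimately show "real_of_int (int j * p (Suc n) mod int Q) + real Q * s j < c * real Q"
      using s_bounds[OF that(1)] cQ by linarith
  qed
  show ?thesis
  proof (cases "x < real t / real k * d n")
    case True
    \<comment> \<open>\<open>X\<close> = t \<open>q n\<close> / k is the index with residue
      \<open>R\<close>. By \<open>det_d\<close> its point, in units of 1 / Q, is c Q + Q (x - (t /
      k) \<open>d n\<close>), hence below c Q under the case assumption.\<close>
    define X where "X = t * m"
    have "X < k * m" using t Q by (simp add: X_def)
    also have "k * m \<le> Q"
      using q_mono[of "n - 1"] m \<open>n > 0\<close> by (simp add: Q_def)
    finally have X: "X \<in> {1..Q}" using t Q m by (auto simp: X_def Suc_le_eq)
    have "int X * p (Suc n) = z * int Q + R"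
      unfolding R X_def by simp
    then have rX: "int X * p (Suc n) mod int Q = R" using R_nonneg R_less by simp
    have sX: "of_int R + real Q * s X < c * real Q"
    proof -
      have "real X * d (Suc n) = real t / real k * (real (q n) * d (Suc n))"
        using k_pos by (simp add: X_def m)
      also have "real (q n) * d (Suc n) = 1 - real Q * d n" using det_d[of n] by (simp add: Q_def)
      finally have "real Q * s X = real Q * (x - real t / real k * d n) + real t / real k"
        unfolding e by (simp add: algebra_simps)
      moreover have "real Q * (x - real t / real k * d n) < 0"
        using True Q by (simp add: mult_less_0_iff)
      ultimately show ?thesis using cQ by linarith
    qed
    have "frac (x + real j * \<beta>) < c"
      if "j \<in> {1..Q}" "int j * p (Suc n) mod int Q \<in> {0..R}" for j
    proof (cases "int j * p (Suc n) mod int Q = R")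
      case True
      have "j = X"
        using inj_onD[OF bij_betw_imp_inj_on[OF bij_betw_residues[OF cop Q(1)]] _ that(1) X] rX True
        by simp
      then show ?thesis
        using frac_less[OF _ that(1), of "of_int R"] sX unfolding True by simp
    next
      case False
      then show ?thesis using inner that by auto
    qed
    then have "S x Q \<ge> real (card {0..R}) - c * real Q"
      using R_less by (intro shifted_discrepancy_ge_card[OF cop Q(1)]) auto
    moreover have "real (card {0..R}) = of_int R + 1" using R_nonneg by simp
    ultimately show ?thesis using True cQ by (simp add: Q_def)
  next
    case False
    have "S x Q \<ge> real (card {0..<R}) - c * real Q"
      using R_less inner by (intro shifted_discrepancy_ge_card[OF cop Q(1)]) auto
    moreover have "real (card {0..<R}) = of_int R" using R_nonneg by simp
    ultimately show ?thesis using False cQ by (simp add: Q_def)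
  qed
qed

end

subsection \<open>Divisibility implies lower boundedness\<close>

context rational_interval
begin

text \<open>Since k divides \<open>a n\<close>, \<open>d_rec\<close> writes the threshold (t / k)
  \<open>d n\<close> as \<open>T\<close> steps of length \<open>d (Suc n)\<close> plus
  \<open>\<epsilon>\<close>, with T = t \<open>a n\<close> / k. Among the b blocks the first
  \<open>T\<close>, or T + 1 if x < \<open>\<epsilon>\<close>, start below it and gain 1 each, while
  all blocks together pay b t / k \<le> T. A full 1 is left over when x < \<open>\<epsilon>\<close>
  and the threshold has been reached.\<close>

lemma blocks_odd:
  assumes "even n" "n > 0" and "k dvd q n" "k dvd a n" and t: "0 < t" "t < k"
    and tp: "int k dvd int t * p n - int h"
    and x: "- d (Suc n) < x" "x < d (Suc (Suc n))" and b: "b \<le> a n"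
  shows "S x (b * q (Suc n)) \<ge>
    (if real t / real k * d n \<le> x + real b * d (Suc n) then 1 else 0) -
    (if real t / real k * d (Suc (Suc n)) \<le> x then 1 else 0)"
proof -
  define \<delta> where "\<delta> = d (Suc n)"
  define \<epsilon> where "\<epsilon> = real t / real k * d (Suc (Suc n))"
  obtain a' where a': "a n = k * a'" using assms(4) by auto
  define T where "T = t * a'"
  have \<delta>: "\<delta> > 0" by (simp add: \<delta>_def d_pos)
  have dn: "d n = real (a n) * \<delta> + d (Suc (Suc n))" using d_rec[of n] by (simp add: \<delta>_def)
  have td: "real t / real k * d n = real T * \<delta> + \<epsilon>"
    unfolding dn T_def \<epsilon>_def using k_pos by (simp add: a' field_simps)
  define T' where "T' = (if x < \<epsilon> then T + 1 else T)"
  have step: "S (x + real s * \<delta>) (q (Suc n)) \<ge> - real t / real k + (if s < T' then 1 else 0)" if "s < b" for s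
  proof -
    have "real s + 1 \<le> real (a n)" using that b by linarith
    then have "(real s + 1) * \<delta> \<le> real (a n) * \<delta>" using \<delta> by (intro mult_right_mono) auto
    then have "x + real s * \<delta> < d n - d (Suc n)"
      using x dn by (simp add: \<delta>_def algebra_simps)
    moreover have "0 \<le> real s * \<delta>" using \<delta> by simp
    then have "- d (Suc n) < x + real s * \<delta>" using x by linarith
    ultimately have "S (x + real s * \<delta>) (q (Suc n)) \<ge>
        - real t / real k + (if x + real s * \<delta> < real t / real k * d n then 1 else 0)"
      using block_odd[OF assms(1-3) t tp] by blast
    moreover have "x + real s * \<delta> < real t / real k * d n" if "s < T'"
    proof (cases "x < \<epsilon>")
      case True
      then have "real s \<le> real T" using that by (simp add: T'_def)
      then have "real s * \<delta> \<le> real T * \<delta>" using \<delta> by (intro mult_right_mono) auto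
      then show ?thesis using True td by linarith
    next
      case False
      then have "real s + 1 \<le> real T" using that by (simp add: T'_def)
      then have "(real s + 1) * \<delta> \<le> real T * \<delta>" using \<delta> by (intro mult_right_mono) auto
      moreover have "x < \<delta>" using x d_decreasing[of "Suc n"] by (simp add: \<delta>_def)
      moreover have "\<epsilon> > 0" using t d_pos by (simp add: \<epsilon>_def)
      ultimately show ?thesis using td by (simp add: algebra_simps)
    qed
    ultimately show ?thesis by (auto split: if_splits)
  qed
  have "S x (b * q (Suc n)) = (\<Sum>s<b. S (x + real s * \<delta>) (q (Suc n)))"
    using q_beta_odd[of "Suc n"] \<open>even n\<close> unfolding \<delta>_def
    by (intro shifted_discrepancy_blocks[where z = "p (Suc n)"]) auto
  also have "\<dots> \<ge> (\<Sum>s<b. - real t / real k + (if s < T' then 1 else 0))"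
    using step by (intro sum_mono) auto
  also have "(\<Sum>s<b. - real t / real k + (if s < T' then 1 else 0)) =
      real (min b T') - real b * (real t / real k)"
  proof -
    have "(\<Sum>s<b. if s < T' then 1 else 0 :: real) = real (card {s \<in> {..<b}. s < T'})"
      by (subst sum.inter_filter[symmetric]) auto
    also have "{s \<in> {..<b}. s < T'} = {..<min b T'}" by auto
    finally show ?thesis by (simp only: sum.distrib) simp
  qed
  finally have main: "S x (b * q (Suc n)) \<ge> real (min b T') - real b * (real t / real k)" .
  have bT: "real b * (real t / real k) \<le> real T"
  proof -
    have "real b * (real t / real k) \<le> real (a n) * (real t / real k)"
      using b by (intro mult_right_mono) auto
    also have "\<dots> = real T" using k_pos by (simp add: a' T_def)
    finally show ?thesis .
  qed
  have bb: "real b * (real t / real k) \<le> real b"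
    using t by (intro mult_left_le) auto
  show ?thesis
  proof (cases "x < \<epsilon>")
    case True
    then have T': "T' = T + 1" by (simp add: T'_def)
    show ?thesis
    proof (cases "real t / real k * d n \<le> x + real b * d (Suc n)")
      case ind: True
      then have "real T * \<delta> < real b * \<delta>" using td True by (simp add: \<delta>_def)
      then have "T < b" using \<delta> by (simp add: mult_less_cancel_right)
      then have "min b T' = T + 1" using T' by simp
      then show ?thesis using main bT True ind by (simp add: \<epsilon>_def)
    next
      case False
      have "real (min b T') - real b * (real t / real k) \<ge> 0"
        using bT bb unfolding T' min_def by auto
      then show ?thesis using main True False by (simp add: \<epsilon>_def)
    qed
  next
    case False
    then have T': "T' = T" by (simp add: T'_def)
    have "real (min b T') - real b * (real t / real k) \<ge> 0"
      using bT bb unfolding T' min_def by auto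
    then show ?thesis using main False by (simp add: \<epsilon>_def)
  qed
qed

text \<open>Each block moves the start down by \<open>d (Suc n)\<close>. From the second block on
  the start is negative, thus below the threshold, so only the first block can lose.\<close>

lemma blocks_even:
  assumes "odd n" and "k dvd q (Suc n)" and t: "0 < t" "t < k"
    and tp: "int k dvd int t * p (Suc n) - int h"
    and x: "- d (Suc (Suc n)) < x" "x < d (Suc n)" and b: "b \<le> a n" "b > 0"
  shows "S x (b * q (Suc n)) \<ge> (if real t / real k * d (Suc n) \<le> x then - 1 else 0)"
proof -
  define \<delta> where "\<delta> = d (Suc n)"
  have \<delta>: "\<delta> > 0" by (simp add: \<delta>_def d_pos)
  have pos: "real t / real k * d (Suc n) > 0" using t d_pos by simp
  have step: "S (x + real s * (- \<delta>)) (q (Suc n)) \<ge>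
      (if s = 0 then if real t / real k * d (Suc n) \<le> x then - 1 else 0 else 0)" if "s < b" for s
  proof -
    have "real s + 1 \<le> real (a n)" using that b by linarith
    then have "(real s + 1) * \<delta> \<le> real (a n) * \<delta>" using \<delta> by (intro mult_right_mono) auto
    then have "- d n + d (Suc n) < x + real s * (- \<delta>)"
      using x d_rec[of n] by (simp add: \<delta>_def algebra_simps)
    moreover have "0 \<le> real s * \<delta>" using \<delta> by simp
    then have "x + real s * (- \<delta>) < d (Suc n)" using x by linarith
    ultimately have "S (x + real s * (- \<delta>)) (q (Suc n)) \<ge>
        (if x + real s * (- \<delta>) < real t / real k * d (Suc n) then 0 else - 1)"
      using block_even[OF assms(1,2) t tp] by blast
    moreover have "x + real s * (- \<delta>) < real t / real k * d (Suc n)" if "s \<noteq> 0"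
    proof -
      have "1 * \<delta> \<le> real s * \<delta>" using that \<delta> by (intro mult_right_mono) auto
      then show ?thesis using x pos by (simp add: \<delta>_def)
    qed
    ultimately show ?thesis by (auto split: if_splits)
  qed
  have "S x (b * q (Suc n)) = (\<Sum>s<b. S (x + real s * (- \<delta>)) (q (Suc n)))"
    using q_beta_even[of "Suc n"] \<open>odd n\<close> unfolding \<delta>_def
    by (intro shifted_discrepancy_blocks[where z = "p (Suc n)"]) auto
  also have "\<dots> \<ge> (\<Sum>s<b. if s = 0 then if real t / real k * d (Suc n) \<le> x then - 1 else 0 else 0)"
    using step by (intro sum_mono) auto
  finally show ?thesis using b by (simp add: sum.delta)
qed

text \<open>A prefix of length \<open>r < q (n + 3)\<close> is cut into blocks of length \<open>q (n + 2)\<close>, followed by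
  blocks of length \<open>q (n + 1)\<close> and a remainder below \<open>q (n + 1)\<close>. The possible loss of \<open>1\<close> in the
  blocks of length \<open>q (n + 1)\<close> occurs only when the preceding blocks have gained \<open>1\<close>.\<close>

lemma remainder_lower_bound_step:
  assumes "odd n" and "k dvd q (Suc n)" "k dvd a (Suc n)" and t: "0 < t" "t < k"
    and tp: "int k dvd int t * p (Suc n) - int h"
    and IH: "\<And>x r. r < q (Suc n) \<Longrightarrow> - d n < x \<Longrightarrow> x < d (Suc n) \<Longrightarrow>
      S x r \<ge> C - (if real t / real k * d (Suc n) \<le> x then 1 else 0)"
    and r: "r < q (Suc (Suc (Suc n)))"
    and x: "- d (Suc (Suc n)) < x" "x < d (Suc (Suc (Suc n)))"
  shows "S x r \<ge> C - (if real t / real k * d (Suc (Suc (Suc n))) \<le> x then 1 else 0)"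
proof -
  define b where "b = r div q (Suc (Suc n))"
  define r1 where "r1 = r mod q (Suc (Suc n))"
  define b1 where "b1 = r1 div q (Suc n)"
  define r2 where "r2 = r1 mod q (Suc n)"
  have r_eq: "r = b * q (Suc (Suc n)) + r1" and r1_eq: "r1 = b1 * q (Suc n) + r2"
    by (simp_all add: b_def r1_def b1_def r2_def)
  have r1: "r1 < q (Suc (Suc n))" and r2: "r2 < q (Suc n)"
    using q_pos[of "Suc (Suc n)"] q_pos[of "Suc n"] by (simp_all add: r1_def r2_def)
  have "n > 0" using \<open>odd n\<close> by (auto intro: Nat.gr0I)
  have b: "b \<le> a (Suc n)"
  proof -
    have "b * q (Suc (Suc n)) < (a (Suc n) + 1) * q (Suc (Suc n))"
      using r q_mono[of n] unfolding r_eq q_rec[of "Suc n"] by simp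
    then have "b < a (Suc n) + 1" by (simp only: mult_less_cancel2)
    then show ?thesis by simp
  qed
  have b1: "b1 \<le> a n"
  proof -
    have "b1 * q (Suc n) < (a n + 1) * q (Suc n)"
      using r1 q_mono[of "n - 1"] \<open>n > 0\<close> unfolding r1_eq q_rec[of n] by simp
    then have "b1 < a n + 1" by (simp only: mult_less_cancel2)
    then show ?thesis by simp
  qed
  define x1 where "x1 = x + real b * d (Suc (Suc n))"
  define x2 where "x2 = x1 - real b1 * d (Suc n)"
  have s1: "S x r = S x (b * q (Suc (Suc n))) + S x1 r1"
    using q_beta_odd[of "Suc (Suc n)"] \<open>odd n\<close> unfolding r_eq x1_def
    by (intro shifted_discrepancy_blocks_add[where z = "p (Suc (Suc n))"]) simp
  have s2: "S x1 r1 = S x1 (b1 * q (Suc n)) + S x2 r2"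
    using shifted_discrepancy_blocks_add[OF q_beta_even[of "Suc n"], of x1 b1 r2 c] \<open>odd n\<close>
    unfolding r1_eq x2_def by simp
  have x1: "- d (Suc (Suc n)) < x1" "x1 < d (Suc n)"
  proof -
    have "0 \<le> real b * d (Suc (Suc n))" using d_pos[of "Suc (Suc n)"] by simp
    then show "- d (Suc (Suc n)) < x1" using x by (simp add: x1_def)
    have "real b * d (Suc (Suc n)) \<le> real (a (Suc n)) * d (Suc (Suc n))"
      using b d_pos[of "Suc (Suc n)"] by (intro mult_right_mono) auto
    then show "x1 < d (Suc n)" using x d_rec[of "Suc n"] by (simp add: x1_def)
  qed
  have x2: "- d n < x2" "x2 < d (Suc n)"
  proof -
    have "0 \<le> real b1 * d (Suc n)" using d_pos[of "Suc n"] by simp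
    then show "x2 < d (Suc n)" using x1 by (simp add: x2_def)
    have "real b1 * d (Suc n) \<le> real (a n) * d (Suc n)"
      using b1 d_pos[of "Suc n"] by (intro mult_right_mono) auto
    then show "- d n < x2" using x1 d_rec[of n] by (simp add: x2_def)
  qed
  have o: "S x (b * q (Suc (Suc n))) \<ge>
    (if real t / real k * d (Suc n) \<le> x1 then 1 else 0) -
    (if real t / real k * d (Suc (Suc (Suc n))) \<le> x then 1 else 0)"
    using blocks_odd[of "Suc n" t x b] assms b by (simp add: x1_def)
  have i: "S x2 r2 \<ge> C - (if real t / real k * d (Suc n) \<le> x2 then 1 else 0)"
    by (rule IH[OF r2 x2])
  show ?thesis
  \<comment> \<open>If \<open>b1\<close> = 0 then \<open>x2\<close> = \<open>x1\<close>, and the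
    gain in \<open>o\<close> pays for the loss in \<open>i\<close>. Otherwise \<open>x2\<close> < 0,
    so \<open>i\<close> has no loss, and the gain pays for the first block of length
    \<open>q (Suc n)\<close>.\<close>
  proof (cases "b1 = 0")
    case True
    then show ?thesis using s1 s2 o i by (simp add: x2_def)
  next
    case False
    then have "real b1 \<ge> 1" by simp
    then have "1 * d (Suc n) \<le> real b1 * d (Suc n)" using d_pos[of "Suc n"] by (intro mult_right_mono) auto
    then have "x2 < 0" using x1 by (simp add: x2_def)
    moreover have "0 < real t / real k * d (Suc n)" using t d_pos by simp
    ultimately have "S x2 r2 \<ge> C" using i by (simp split: if_splits)
    moreover have "S x1 (b1 * q (Suc n)) \<ge> (if real t / real k * d (Suc n) \<le> x1 then - 1 else 0)"
      using blocks_even[OF assms(1,2) t tp x1 b1] False by simp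
    ultimately show ?thesis using s1 s2 o by (auto split: if_splits)
  qed
qed

lemma dvd_a:
  assumes "k dvd q n" "k dvd q (Suc (Suc n))"
  shows "k dvd a n"
proof -
  have "k dvd a n * q (Suc n)"
    using assms unfolding q_rec by (simp add: dvd_add_left_iff)
  moreover have "coprime k (q (Suc n))"
    using assms(1) coprime_q_q[of n] by (rule coprime_divisors[OF _ dvd_refl])
  ultimately show ?thesis by (simp add: coprime_dvd_mult_left_iff)
qed

text \<open>\<open>t\<close> is h times an inverse of \<open>p n\<close> modulo k, which exists
  because \<open>p n\<close> is coprime to a multiple of k. It is nonzero since 0 < h < k.\<close>

lemma exists_multiplier:
  assumes "k dvd q n"
  shows "\<exists>t. 0 < t \<and> t < k \<and> int k dvd int t * p n - int h"
proof -
  have "coprime (p n) (int k)"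
    using assms by (intro coprime_divisors[OF dvd_refl _ coprime_p_q[of n]]) simp
  then obtain u v where uv: "u * p n + v * int k = 1"
    using bezout_int[of "p n" "int k"] by (metis coprime_imp_gcd_eq_1)
  define t where "t = nat (u * int h mod int k)"
  have t: "int t = u * int h mod int k" using k_pos by (simp add: t_def)
  have "int k dvd u * int h - int t" unfolding t by (simp only: minus_mod_eq_mult_div dvd_triv_left)
  then have "int k dvd (u * int h - int t) * p n + v * int h * int k" by simp
  also have "(u * int h - int t) * p n + v * int h * int k = int h * (u * p n + v * int k) - int t * p n"
    by (simp add: algebra_simps)
  finally have *: "int k dvd int t * p n - int h" unfolding uv by (simp only: mult_1_right dvd_diff_commute)
  have "t \<noteq> 0"
  proof
    assume "t = 0"
    then have "k dvd h" using * by simp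
    then show False using h_pos h_less by (auto dest: dvd_imp_le)
  qed
  moreover have "int t < int k" unfolding t using k_pos by (intro pos_mod_bound) simp
  ultimately show ?thesis using * by auto
qed

lemma bounded_below:
  assumes dvd: "\<And>n. n \<ge> m \<Longrightarrow> k dvd q (2 * n)"
  shows "\<exists>C. \<forall>n. discrepancy n \<beta> c \<ge> C"
proof -
  define n0 where "n0 = 2 * m + 1"
  have even: "k dvd q (Suc (n0 + 2 * s))" for s
    using dvd[of "m + s + 1"] by (simp add: n0_def algebra_simps)
  obtain t where t: "0 < t" "t < k" and t0: "int k dvd int t * p (Suc n0) - int h"
    using exists_multiplier even[of 0] by auto
  \<comment> \<open>The base case only uses that r points lose at most r, and there r <
    \<open>q (Suc n0)\<close>.\<close>
  define C where "C = - real (q (Suc n0))"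
  have ka: "k dvd a (Suc (n0 + 2 * s))" for s
    using dvd_a even[of s] even[of "Suc s"] by simp
  \<comment> \<open>As k divides the multipliers \<open>ka\<close>, the numerators at these even
    indices agree modulo k, so one \<open>t\<close> serves all levels.\<close>
  have tp: "int k dvd int t * p (Suc (n0 + 2 * s)) - int h" for s
  proof (induction s)
    case 0
    then show ?case using t0 by simp
  next
    case (Suc s)
    have "int k dvd int (a (Suc (n0 + 2 * s)))" using ka[of s] by simp
    then have "int k dvd int t * (int (a (Suc (n0 + 2 * s))) * p (Suc (Suc (n0 + 2 * s)))) +
      (int t * p (Suc (n0 + 2 * s)) - int h)"
      using Suc by simp
    then show ?case by (simp add: p_rec algebra_simps)
  qed
  have main: "S x r \<ge> C - (if real t / real k * d (Suc (n0 + 2 * s)) \<le> x then 1 else 0)"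
    if "r < q (Suc (n0 + 2 * s))" "- d (n0 + 2 * s) < x" "x < d (Suc (n0 + 2 * s))" for x r s
    using that
  proof (induction s arbitrary: x r)
    case 0
    have "S x r \<ge> - real r" using c_bounds by (intro shifted_discrepancy_ge) auto
    then show ?case using 0(1) by (simp add: C_def)
  next
    case (Suc s)
    have "odd (n0 + 2 * s)" by (simp add: n0_def)
    from remainder_lower_bound_step[OF this even ka t tp Suc.IH, of r x] Suc.prems
    show ?case by (simp add: numeral_2_eq_2)
  qed
  have "discrepancy n \<beta> c \<ge> C" for n
  proof -
    \<comment> \<open>Level s = n is high enough for a prefix of length n, and the start 0 is below
      the threshold, so the bound is \<open>C\<close> itself.\<close>
    have "n < q (Suc (n0 + 2 * n))" using q_ge[of "Suc (n0 + 2 * n)"] by simp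
    moreover have "0 < real t / real k * d (Suc (n0 + 2 * n))" using t d_pos by simp
    ultimately show ?thesis
      using main[of n n 0] d_pos[of "n0 + 2 * n"] d_pos[of "Suc (n0 + 2 * n)"]
      unfolding discrepancy_eq_shifted by (auto split: if_splits)
  qed
  then show ?thesis by blast
qed

end

subsection \<open>Lower boundedness implies divisibility\<close>

context rational_interval
begin

section \<open>Subadditivity of discrepancies along denominators\<close>

lemma mult_irrational: "j > 0 \<Longrightarrow> real j * \<beta> \<notin> \<rat>"
proof
  assume j: "j > 0" and "real j * \<beta> \<in> \<rat>"
  then have "real j * \<beta> / real j \<in> \<rat>" by (intro Rats_divide) auto
  then show False using irrational j by simp
qed

text \<open>No orbit point equals c, since \<beta> is irrational and c rational. A point outside [0,
  c) therefore has positive distance from c and from 1 and stays outside after a small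
  shift.\<close>

lemma eventually_shifted_le: "\<forall>\<^sub>F x in nhds 0. S x n \<le> S 0 n"
proof -
  have "\<forall>\<^sub>F x in nhds 0. frac (x + real j * \<beta>) < c \<longrightarrow> frac (real j * \<beta>) < c" if "j \<in> {1..n}" for j
  proof (cases "frac (real j * \<beta>) < c")
    case True
    then show ?thesis by simp
  next
    case False
    have "frac (real j * \<beta>) \<noteq> c"
    proof
      assume "frac (real j * \<beta>) = c"
      then have "frac (real j * \<beta>) \<in> \<rat>" by (simp add: c_eq)
      then show False using mult_irrational[of j] that by simp
    qed
    then have gt: "frac (real j * \<beta>) > c" using False by simp
    define e where "e = min (frac (real j * \<beta>) - c) (1 - frac (real j * \<beta>))"
    have "e > 0" using gt frac_lt_1[of "real j * \<beta>"] by (simp add: e_def)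
    moreover have "\<not> frac (x + real j * \<beta>) < c" if "dist x 0 < e" for x
    proof -
      have "\<bar>x\<bar> < frac (real j * \<beta>) - c" "\<bar>x\<bar> < 1 - frac (real j * \<beta>)"
        using that by (simp_all add: e_def)
      then have b: "c < x + frac (real j * \<beta>)" "x + frac (real j * \<beta>) < 1" by linarith+
      have "frac (x + real j * \<beta>) = x + frac (real j * \<beta>)"
        using b c_bounds by (intro frac_eqI[where z = "\<lfloor>real j * \<beta>\<rfloor>"]) (auto simp: frac_def)
      then show ?thesis using b by simp
    qed
    ultimately show ?thesis unfolding eventually_nhds_metric by blast
  qed
  then have "\<forall>\<^sub>F x in nhds 0. \<forall>j\<in>{1..n}. frac (x + real j * \<beta>) < c \<longrightarrow> frac (real j * \<beta>) < c"
    by (intro eventually_ball_finite) auto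
  then show ?thesis
  proof eventually_elim
    case (elim x)
    then have "card {j \<in> {1..n}. frac (x + real j * \<beta>) < c} \<le> card {j \<in> {1..n}. frac (0 + real j * \<beta>) < c}"
      by (intro card_mono) auto
    then show ?case unfolding shifted_discrepancy_card by simp
  qed
qed

text \<open>After \<open>q i\<close> steps the orbit restarts, modulo 1, at \<open>q i\<close>
  \<beta> - \<open>p i\<close>, which tends to 0.\<close>

lemma eventually_concat:
  "\<forall>\<^sub>F i in sequentially. discrepancy (q i + n) \<beta> c \<le> discrepancy (q i) \<beta> c + discrepancy n \<beta> c"
proof -
  define l where "l i = real (q i) * \<beta> - of_int (p i)" for i
  have "l \<longlonglongrightarrow> 0"
    using d_tendsto_0 unfolding d_def l_def by (rule tendsto_rabs_zero_cancel)
  from filterlim_iff[THEN iffD1, OF this] eventually_shifted_le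
  have "\<forall>\<^sub>F i in sequentially. S (l i) n \<le> S 0 n" by blast
  then show ?thesis
  proof eventually_elim
    case (elim i)
    have "real (q i) * \<beta> = of_int (p i) + l i" by (simp add: l_def)
    from shifted_discrepancy_block[OF this, of 0 n c] elim show ?case
      by (simp add: discrepancy_eq_shifted)
  qed
qed

lemma discrepancy_neg:
  assumes "discrepancy n \<beta> c < 0"
  shows "discrepancy n \<beta> c \<le> - 1 / real k"
proof -
  define N where "N = card {j \<in> {1..n}. frac (0 + real j * \<beta>) < c}"
  have eq: "real k * discrepancy n \<beta> c = of_int (int k * int N - int h * int n)"
    using k_pos by (simp add: discrepancy_eq_shifted shifted_discrepancy_card N_def c_eq field_simps)
  have "real k * discrepancy n \<beta> c < 0" using assms k_pos by (simp add: mult_less_0_iff)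
  then have "int k * int N - int h * int n < 0" by (simp only: eq of_int_less_0_iff)
  then have "int k * int N - int h * int n \<le> - 1" by linarith
  then have "real k * discrepancy n \<beta> c \<le> real_of_int (- 1)" by (simp only: eq of_int_le_iff)
  then show ?thesis using k_pos by (simp add: field_simps)
qed

text \<open>By \<open>eventually_concat\<close>, infinitely many negative values at denominators would add up.\<close>

lemma eventually_discrepancy_q_nonneg:
  assumes bdd: "\<And>n. discrepancy n \<beta> c \<ge> C"
  shows "\<forall>\<^sub>F i in sequentially. discrepancy (q i) \<beta> c \<ge> 0"
proof (rule ccontr)
  assume "\<not> ?thesis"
  then have freq: "\<exists>\<^sub>F i in sequentially. discrepancy (q i) \<beta> c < 0"
    by (simp add: frequently_def not_less)
  have "\<exists>n. discrepancy n \<beta> c \<le> - real m / real k" for m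
  proof (induction m)
    case 0
    have "discrepancy 0 \<beta> c = 0" by (simp add: discrepancy_def)
    then show ?case by (intro exI[of _ 0]) simp
  next
    case (Suc m)
    then obtain n where n: "discrepancy n \<beta> c \<le> - real m / real k" by blast
    from frequently_ex[OF frequently_eventually_frequently[OF freq eventually_concat[of n]]]
    obtain i where i: "discrepancy (q i) \<beta> c < 0"
      "discrepancy (q i + n) \<beta> c \<le> discrepancy (q i) \<beta> c + discrepancy n \<beta> c"
      by blast
    have "discrepancy (q i + n) \<beta> c \<le> - 1 / real k + - real m / real k"
      using i discrepancy_neg[OF i(1)] n by linarith
    also have "\<dots> = - real (Suc m) / real k" by (simp add: add_divide_distrib diff_divide_distrib)
    finally show ?case by blast
  qed
  moreover obtain m :: nat where "real m > - C * real k" using reals_Archimedean2 by blast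
  ultimately obtain n where "discrepancy n \<beta> c \<le> - real m / real k" by blast
  then have "C \<le> - real m / real k" using bdd[of n] by linarith
  then have "real m \<le> - C * real k" using k_pos by (simp add: field_simps)
  then show False using \<open>real m > - C * real k\<close> by linarith
qed

text \<open>This is k times the distance from c \<open>q n\<close> up to the next integer, i.e. k
  times the fractional part of - c \<open>q n\<close>.\<close>

definition neg_residue :: "nat \<Rightarrow> int" where
  "neg_residue n = - (int h * int (q n)) mod int k"

lemma neg_residue_bounds: "0 \<le> neg_residue n" "neg_residue n < int k"
  using k_pos by (simp_all add: neg_residue_def)

lemma neg_residue_eqI:
  assumes "0 \<le> r" "r < int k" "int k dvd r + int h * int (q n)"
  shows "neg_residue n = r"
proof -
  have "- (int h * int (q n)) mod int k = r mod int k"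
    using assms(3) by (simp only: mod_eq_dvd_iff) (metis dvd_minus_iff minus_diff_eq diff_minus_eq_add)
  then show ?thesis using assms(1,2) by (simp add: neg_residue_def)
qed

lemma neg_residue_dvd: "int k dvd neg_residue n + int h * int (q n)"
proof -
  have "neg_residue n = - (int h * int (q n)) - int k * (- (int h * int (q n)) div int k)"
    unfolding neg_residue_def by (rule minus_mult_div_eq_mod[symmetric])
  then have "neg_residue n + int h * int (q n) = int k * - (- (int h * int (q n)) div int k)" by simp
  then show ?thesis by (rule dvdI)
qed

lemma neg_residue_eq_0_iff: "neg_residue n = 0 \<longleftrightarrow> k dvd q n"
proof -
  have "neg_residue n = 0 \<longleftrightarrow> int k dvd int (h * q n)" by (simp add: neg_residue_def mod_eq_0_iff_dvd)
  also have "\<dots> \<longleftrightarrow> k dvd h * q n" by (simp only: of_nat_dvd_iff)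
  also have "\<dots> \<longleftrightarrow> k dvd q n" using coprime_h_k by (simp add: coprime_commute coprime_dvd_mult_right_iff)
  finally show ?thesis .
qed

lemma neg_residue_cong:
  "int k dvd int (a n) * neg_residue (Suc n) + neg_residue n - neg_residue (Suc (Suc n))"
proof -
  have "int k dvd int (a n) * (neg_residue (Suc n) + int h * int (q (Suc n))) +
    (neg_residue n + int h * int (q n)) - (neg_residue (Suc (Suc n)) + int h * int (q (Suc (Suc n))))"
    by (intro dvd_diff dvd_add dvd_mult[OF neg_residue_dvd] neg_residue_dvd)
  then show ?thesis by (simp add: q_rec algebra_simps)
qed

text \<open>If \<open>k\<close> does not divide \<open>q (Suc n)\<close>, the rational rotation by \<open>p (Suc n) / q (Suc n)\<close> has
  a negative discrepancy after a full period. It can only be compensated by some \<open>j\<close> for which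
  \<open>j * p (Suc n) / q (Suc n)\<close> and \<open>j * \<beta>\<close> lie on different sides of \<open>c\<close> modulo \<open>1\<close>; the conclusion
  follows by writing the corresponding point of the shifted lattice in the basis formed by
  two consecutive convergents.\<close>

lemma neg_residue_less:
  assumes "odd n" and ndvd: "\<not> k dvd q (Suc n)" and nonneg: "discrepancy (q (Suc n)) \<beta> c \<ge> 0"
    and dc: "d (Suc n) \<le> 1 - c"
  shows "int (a n) * neg_residue (Suc n) < neg_residue (Suc (Suc n))"
proof -
  define Q where "Q = q (Suc n)"
  define P where "P = p (Suc n)"
  define R where "R = int h * int Q div int k"
  have Q: "Q \<ge> 1" using q_pos by (simp add: Q_def)
  have cop: "coprime P (int Q)" using coprime_p_q by (simp add: P_def Q_def)
  have "\<not> k dvd h * Q"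
    using ndvd coprime_h_k by (simp add: Q_def coprime_commute coprime_dvd_mult_right_iff)
  then have "\<not> int k dvd int h * int Q" by (simp flip: of_nat_mult)
  then have "int h * int Q mod int k \<noteq> 0" by (simp add: mod_eq_0_iff_dvd)
  moreover have "int h * int Q mod int k \<ge> 0" "int h * int Q mod int k < int k" using k_pos by simp_all
  moreover have hR: "int h * int Q = int k * R + int h * int Q mod int k" by (simp add: R_def)
  ultimately have R: "int k * R < int h * int Q" "int h * int Q < int k * (R + 1)"
    by (simp_all add: algebra_simps)
  have R0: "0 \<le> R" using k_pos by (simp add: R_def pos_imp_zdiv_nonneg_iff)
  have RQ: "R < int Q"
  proof -
    have "int h * int Q \<le> int k * int Q" using h_less by (intro mult_right_mono) auto
    then have "int k * R < int k * int Q" using R by linarith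
    then show ?thesis using k_pos by (simp only: mult_less_cancel_left)
  qed
  have Qb: "real Q * \<beta> - of_int P = - d (Suc n)"
    using q_beta_even[of "Suc n"] \<open>odd n\<close> by (simp add: Q_def P_def)
  \<comment> \<open>\<open>R\<close> is the integer part of c Q, which is not an integer. If only
    residues 1, ..., R were hit, the discrepancy would be at most R - c Q < 0.\<close>
  have "\<exists>j\<in>{1..Q}. frac (0 + real j * \<beta>) < c \<and> int j * P mod int Q \<notin> {1..R}"
  proof (rule ccontr)
    assume "\<not> ?thesis"
    then have "S 0 Q \<le> real (card {1..R}) - c * real Q"
      using RQ by (intro shifted_discrepancy_le_card[OF cop Q]) auto
    also have "real (card {1..R}) = of_int R" using R0 by simp
    finally have "0 \<le> of_int R - c * real Q"
      using nonneg by (simp add: discrepancy_eq_shifted Q_def)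
    moreover have "of_int R < c * real Q"
    proof -
      have "real_of_int (int k * R) < real_of_int (int h * int Q)" using R(1) by (simp only: of_int_less_iff)
      then show ?thesis using k_pos by (simp add: c_eq field_simps)
    qed
    ultimately show False by linarith
  qed
  then obtain j where j: "j \<in> {1..Q}" "frac (real j * \<beta>) < c" "int j * P mod int Q \<notin> {1..R}" by auto
  define r where "r = int j * P mod int Q"
  define z where "z = int j * P div int Q"
  have jP: "int j * P = int Q * z + r" by (simp add: r_def z_def)
  \<comment> \<open>The index Q falls just below 1, outside [0, c) by \<open>dc\<close>. So j
    differs from Q, residue 0 is excluded as well, and r \<ge> R + 1.\<close>
  have "frac (real Q * \<beta>) = 1 - d (Suc n)"
    using Qb dc c_bounds d_pos[of "Suc n"] by (intro frac_eqI[where z = "P - 1"]) auto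
  then have "j \<noteq> Q" using j(2) dc by auto
  then have jQ: "j < Q" using j(1) by simp
  have "r \<noteq> 0"
  proof
    assume "r = 0"
    then have "int Q dvd int j"
      using cop unfolding r_def by (metis coprime_commute coprime_dvd_mult_left_iff mod_0_imp_dvd)
    then show False using j(1) jQ by (auto dest: dvd_imp_le)
  qed
  moreover have "0 \<le> r" "r < int Q" using Q by (simp_all add: r_def)
  ultimately have r: "1 \<le> r" "R + 1 \<le> r" "r < int Q" using j(3) unfolding r_def[symmetric] by auto
  have dQ: "real Q * d (Suc n) < 1"
  proof -
    have "real Q * d (Suc n) \<le> real (q (Suc (Suc n))) * d (Suc n)"
      using q_mono[of n] d_pos[of "Suc n"] by (intro mult_right_mono) (auto simp: Q_def)
    then show ?thesis using d_mult_less[of "Suc n"] by linarith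
  qed
  have jd: "real j * d (Suc n) < 1" "0 < real j * d (Suc n)"
  proof -
    have "real j * d (Suc n) \<le> real Q * d (Suc n)"
      using j(1) d_pos[of "Suc n"] by (intro mult_right_mono) auto
    then show "real j * d (Suc n) < 1" using dQ by linarith
    show "0 < real j * d (Suc n)" using j(1) d_pos[of "Suc n"] by simp
  qed
  have j\<beta>: "real j * \<beta> = of_int z + (of_int r - real j * d (Suc n)) / real Q"
    using block_point[OF Q, of 0 j \<beta> P] unfolding Qb r_def z_def
    by (simp add: diff_divide_distrib)
  have "frac (real j * \<beta>) = (of_int r - real j * d (Suc n)) / real Q"
    using j\<beta>
  proof (rule frac_eqI)
    have "1 \<le> real_of_int r" "real_of_int r < real Q" using r by linarith+
    then show "0 \<le> (of_int r - real j * d (Suc n)) / real Q" "(of_int r - real j * d (Suc n)) / real Q < 1"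
      using jd Q by (simp_all add: field_simps)
  qed
  then have less: "(of_int r - real j * d (Suc n)) / real Q < c" using j(2) by simp
  \<comment> \<open>\<open>A\<close> and \<open>B\<close> are the coordinates of (k j, Y) = k (j, z
    + c) in the basis of (q, p) at n + 1 and n + 2. \<open>B\<close> > 0 because the rational point
    lies beyond c, and \<open>A\<close> > 0 because j \<beta> lies below z + c.\<close>
  define Y where "Y = int k * z + int h"
  define B where "B = int k * int j * P - int Q * Y"
  define A where "A = int (q (Suc (Suc n))) * Y - int k * int j * p (Suc (Suc n))"
  have Br: "B = int k * r - int h * int Q"
  proof -
    have "B = int k * (int j * P) - int Q * Y" by (simp add: B_def)
    then show ?thesis unfolding jP Y_def by (simp add: algebra_simps)
  qed
  have B_pos: "0 < B"
  proof -
    have "int k * (R + 1) \<le> int k * r" using r(2) by (intro mult_left_mono) auto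
    then show ?thesis using R(2) unfolding Br by linarith
  qed
  have "B < int k"
  proof -
    have "of_int r - real j * d (Suc n) < c * real Q" using less Q by (simp add: field_simps)
    then have "of_int r < c * real Q + 1" using jd by linarith
    then have "real k * of_int r < real h * real Q + real k" using k_pos by (simp add: c_eq field_simps)
    then have "real_of_int B < real_of_int (int k)" unfolding Br by simp
    then show ?thesis by (simp only: of_int_less_iff)
  qed
  moreover have "int k dvd B + int h * int (q (Suc n))" unfolding Br Q_def[symmetric] by simp
  ultimately have B: "neg_residue (Suc n) = B" using B_pos by (intro neg_residue_eqI) auto
  have AB: "A * int Q + B * int (q (Suc (Suc n))) = int k * int j"
  proof -
    have "A * int Q + B * int (q (Suc (Suc n))) =
      int k * int j * (p (Suc n) * int (q (Suc (Suc n))) - p (Suc (Suc n)) * int (q (Suc n)))"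
      by (simp add: A_def B_def P_def Q_def algebra_simps)
    then show ?thesis unfolding det[of "Suc n"] using \<open>odd n\<close> by simp
  qed
  have A_pos: "0 < A"
  proof -
    have "real k * (real j * \<beta>) < of_int Y"
      using less k_pos unfolding j\<beta> Y_def by (simp add: c_eq field_simps)
    then have "real (q (Suc (Suc n))) * (real k * (real j * \<beta>)) < real (q (Suc (Suc n))) * of_int Y"
      using q_pos[of "Suc (Suc n)"] by (intro mult_strict_left_mono) auto
    moreover have "real (q (Suc (Suc n))) * (real k * (real j * \<beta>)) =
      real k * real j * (of_int (p (Suc (Suc n))) + d (Suc (Suc n)))"
      using q_beta_odd[of "Suc (Suc n)"] \<open>odd n\<close> by (simp add: mult_ac)
    moreover have "0 \<le> real k * real j * d (Suc (Suc n))" using d_pos[of "Suc (Suc n)"] by simp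
    ultimately have "0 < real_of_int A" by (simp add: A_def algebra_simps)
    then show ?thesis by simp
  qed
  have kj: "int k * int j < int k * int Q" using jQ k_pos by simp
  have "0 \<le> B * int (q (Suc (Suc n)))" using B_pos by simp
  then have "A * int Q < int k * int Q" using AB kj by linarith
  then have "A < int k" using Q by (simp add: mult_less_cancel_right)
  moreover have "int k dvd int k - A + int h * int (q (Suc (Suc n)))"
    unfolding A_def Y_def by (auto simp: algebra_simps intro!: dvd_add dvd_diff)
  ultimately have A: "neg_residue (Suc (Suc n)) = int k - A"
    using A_pos by (intro neg_residue_eqI) auto
  \<comment> \<open>Combine \<open>AB\<close> with j < Q and \<open>q (Suc (Suc n))\<close> \<ge>
    \<open>a n\<close> Q, then cancel Q.\<close>
  have "B * (int (a n) * int Q) \<le> B * int (q (Suc (Suc n)))"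
    using B_pos by (intro mult_left_mono) (auto simp: q_rec Q_def)
  also have "\<dots> < (int k - A) * int Q" using AB kj by (simp add: algebra_simps)
  finally have "int (a n) * B * int Q < (int k - A) * int Q" by (simp add: mult_ac)
  then have "int (a n) * B < int k - A" using Q by (simp add: mult_less_cancel_right)
  then show ?thesis unfolding A B .
qed

text \<open>The recurrence of the residues holds modulo k by \<open>neg_residue_cong\<close>.
  \<open>neg_residue_less\<close> makes the two sides differ by less than k, so it holds exactly,
  and the term with \<open>a n\<close> is at least 1 unless k divides
  \<open>q (Suc n)\<close>.\<close>

lemma neg_residue_step:
  assumes "odd n" and nonneg: "discrepancy (q (Suc n)) \<beta> c \<ge> 0" and dc: "d (Suc n) \<le> 1 - c"
  shows "neg_residue n + (if k dvd q (Suc n) then 0 else 1) \<le> neg_residue (Suc (Suc n))"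
proof -
  let ?D = "int (a n) * neg_residue (Suc n) + neg_residue n - neg_residue (Suc (Suc n))"
  note bounds = neg_residue_bounds[of n] neg_residue_bounds[of "Suc n"] neg_residue_bounds[of "Suc (Suc n)"]
  have nn: "0 \<le> int (a n) * neg_residue (Suc n)" using bounds by simp
  have le: "int (a n) * neg_residue (Suc n) \<le> neg_residue (Suc (Suc n))"
  proof (cases "k dvd q (Suc n)")
    case True
    then show ?thesis using neg_residue_eq_0_iff[of "Suc n"] bounds by simp
  next
    case False
    then show ?thesis using neg_residue_less[OF assms(1) False nonneg dc] by simp
  qed
  have "\<bar>?D\<bar> < int k" using bounds nn le by linarith
  then have "?D = 0" using neg_residue_cong[of n] dvd_imp_le_int[of ?D "int k"] by linarith
  moreover have "int (a n) * neg_residue (Suc n) \<ge> 1" if "\<not> k dvd q (Suc n)"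
  proof -
    have "neg_residue (Suc n) \<noteq> 0" using that neg_residue_eq_0_iff by simp
    then have "1 \<le> neg_residue (Suc n)" using bounds by linarith
    moreover have "1 * neg_residue (Suc n) \<le> int (a n) * neg_residue (Suc n)"
      using a_pos[of n] bounds by (intro mult_right_mono) auto
    ultimately show ?thesis by linarith
  qed
  ultimately show ?thesis using nn by auto
qed

lemma eventually_dvd:
  assumes bdd: "\<And>n. discrepancy n \<beta> c \<ge> C"
  shows "\<exists>m. \<forall>n\<ge>m. k dvd q (2 * n)"
proof -
  have "\<forall>\<^sub>F i in sequentially. d i < 1 - c"
    using d_tendsto_0 c_bounds by (intro order_tendstoD(2)) auto
  with eventually_discrepancy_q_nonneg[OF bdd]
  have "\<forall>\<^sub>F i in sequentially. discrepancy (q i) \<beta> c \<ge> 0 \<and> d i \<le> 1 - c"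
    by eventually_elim simp
  then obtain N where N: "\<And>i. i \<ge> N \<Longrightarrow> discrepancy (q i) \<beta> c \<ge> 0 \<and> d i \<le> 1 - c"
    by (auto simp: eventually_sequentially)
  \<comment> \<open>Values at odd indices are compared across the even index 2 s + 2. From N on they
    never drop, they rise at each exceptional even index, and they stay below k.\<close>
  define f where "f s = neg_residue (2 * s + 1)" for s
  have step: "f s + (if k dvd q (2 * Suc s) then 0 else 1) \<le> f (Suc s)" if "s \<ge> N" for s
    using neg_residue_step[of "2 * s + 1"] N[of "2 * s + 2"] that by (simp add: f_def)
  have mono: "f s \<le> f (s + l)" if "s \<ge> N" for s l
  proof (induction l)
    case (Suc l)
    then show ?case using step[of "s + l"] that by (auto split: if_splits)
  qed simp
  show ?thesis
  proof (rule ccontr)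
    assume "\<not> ?thesis"
    then have inf: "\<exists>n\<ge>m. \<not> k dvd q (2 * n)" for m by blast
    have "\<exists>s\<ge>N. f s \<ge> int l" for l
    proof (induction l)
      case 0
      then show ?case using neg_residue_bounds by (auto simp: f_def)
    next
      case (Suc l)
      then obtain s where s: "s \<ge> N" "f s \<ge> int l" by blast
      obtain n where n: "n \<ge> Suc s" "\<not> k dvd q (2 * n)" using inf by blast
      obtain u where u: "n = Suc (s + u)" using n(1) by (metis add_Suc le_Suc_ex)
      have "f (s + u) + 1 \<le> f (Suc (s + u))" using step[of "s + u"] s n u by simp
      then have "f (Suc (s + u)) \<ge> int (Suc l)" using mono[OF s(1), of u] s by simp
      then show ?case using s(1) by (intro exI[of _ "Suc (s + u)"]) simp
    qed
    then obtain s where "f s \<ge> int k" by blast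
    then show False using neg_residue_bounds[of "2 * s + 1"] by (simp add: f_def)
  qed
qed

theorem bounded_below_iff:
  "(\<exists>C. \<forall>n. discrepancy n \<beta> c \<ge> C) \<longleftrightarrow> (\<exists>m. \<forall>n\<ge>m. k dvd q (2 * n))"
  using bounded_below eventually_dvd by blast

end

subsection \<open>Application to continued fractions\<close>

lemma SUP_ereal_less_infinity_iff:
  "(SUP n::nat. ereal (f n)) < \<infinity> \<longleftrightarrow> (\<exists>C. \<forall>n. f n \<le> C)"
proof
  assume "(SUP n. ereal (f n)) < \<infinity>"
  then obtain C :: real where "(SUP n. ereal (f n)) < ereal C"
    using less_PInf_Ex_of_nat by auto
  then have "ereal (f n) \<le> ereal C" for n
    using SUP_upper[of n UNIV "\<lambda>n. ereal (f n)"] by (meson UNIV_I less_imp_le order_trans)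
  then show "\<exists>C. \<forall>n. f n \<le> C" by auto
next
  assume "\<exists>C. \<forall>n. f n \<le> C"
  then obtain C where "\<And>n. f n \<le> C" by blast
  then have "(SUP n. ereal (f n)) \<le> ereal C" by (intro SUP_least) simp
  then show "(SUP n. ereal (f n)) < \<infinity>" by (rule le_less_trans) simp
qed

lemma bounded_above_uminus_iff:
  fixes f :: "nat \<Rightarrow> real"
  shows "(\<exists>C. \<forall>n. - f n \<le> C) \<longleftrightarrow> (\<exists>C. \<forall>n. f n \<ge> C)"
proof safe
  fix C assume "\<forall>n. - f n \<le> C"
  then show "\<exists>C. \<forall>n. f n \<ge> C" by (intro exI[of _ "- C"]) (auto simp: minus_le_iff)
next
  fix C assume "\<forall>n. f n \<ge> C"
  then show "\<exists>C. \<forall>n. - f n \<le> C" by (intro exI[of _ "- C"]) auto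
qed

lemma INF_ereal_greater_minus_infinity_iff:
  "(INF n::nat. ereal (f n)) > - \<infinity> \<longleftrightarrow> (\<exists>C. \<forall>n. f n \<ge> C)"
proof -
  have "(INF n. ereal (f n)) = - (SUP n. ereal (- f n))"
    using ereal_INF_uminus_eq[of "\<lambda>n. ereal (- f n)" UNIV] by simp
  then have "(INF n. ereal (f n)) > - \<infinity> \<longleftrightarrow> (SUP n. ereal (- f n)) < \<infinity>"
    by (simp add: ereal_uminus_less_reorder)
  also have "\<dots> \<longleftrightarrow> (\<exists>C. \<forall>n. - f n \<le> C)" by (rule SUP_ereal_less_infinity_iff)
  also have "\<dots> \<longleftrightarrow> (\<exists>C. \<forall>n. f n \<ge> C)"
    by (rule bounded_above_uminus_iff)
  finally show ?thesis .
qed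

section \<open>Divisibility of denominators and tuples of type k\<close>

lemma cf_den_cong:
  assumes "\<And>i. int i \<le> n \<Longrightarrow> a i = b i"
  shows "cf_den a n = cf_den b n"
  using assms
proof (induction a n rule: cf_den.induct)
  case (1 a n)
  consider "n \<le> - 2" | "n = - 1" | "n \<ge> 0" by linarith
  then show ?case
  proof cases
    case 3
    have "cf_den a (n - 1) = cf_den b (n - 1)" "cf_den a (n - 2) = cf_den b (n - 2)"
      using 1 3 by auto
    then show ?thesis using 3 1(3)[of "nat n"] by (simp add: cf_den_simps(3))
  qed (simp_all add: cf_den.simps[of _ n])
qed

lemma coprime_cf_den: "m \<ge> - 1 \<Longrightarrow> coprime (cf_den a (m - 1)) (cf_den a m)"
proof -
  assume "m \<ge> - 1"
  define n where "n = nat (m + 1)"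
  have n: "int n - 1 = m" "int n - 2 = m - 1" using \<open>m \<ge> - 1\<close> by (simp_all add: n_def)
  have "real_of_int (int (cf_num a m) * int (cf_den a (m - 1)) - int (cf_num a (m - 1)) * int (cf_den a m)) =
    real_of_int ((- 1) ^ n)"
    using cf_determinant[of a n] unfolding n by simp
  then have det: "int (cf_num a m) * int (cf_den a (m - 1)) - int (cf_num a (m - 1)) * int (cf_den a m) = (- 1) ^ n"
    by (simp only: of_int_eq_iff)
  have "coprime (int (cf_den a (m - 1))) (int (cf_den a m))"
  proof (rule coprimeI)
    fix x assume "x dvd int (cf_den a (m - 1))" "x dvd int (cf_den a m)"
    then have "x dvd (- 1) ^ n" unfolding det[symmetric] by (intro dvd_diff) auto
    then show "is_unit x" by (rule dvd_unit_imp_unit) (simp add: is_unit_power_iff)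
  qed
  then show ?thesis by simp
qed

text \<open>Consecutive denominators are coprime, so if k \<ge> 2 divides the last one, the first
  component of the character is automatically nonzero.\<close>

lemma of_type_iff:
  assumes "k \<ge> 2" "m \<ge> - 1"
  shows "of_type k (map a [0..<nat (m + 1)]) \<longleftrightarrow> k dvd cf_den a m"
proof -
  let ?M = "map a [0..<nat (m + 1)]"
  have "cf_den ((!) ?M) l = cf_den a l" if "l \<le> m" for l
    using that by (intro cf_den_cong) auto
  then have char: "character k ?M = (cf_den a (m - 1) mod k, cf_den a m mod k)"
    using assms(2) by (simp add: character_def Let_def)
  have "cf_den a (m - 1) mod k \<in> {1..k - 1}" if "k dvd cf_den a m"
  proof -
    have "\<not> k dvd cf_den a (m - 1)"
      using coprime_common_divisor[OF coprime_cf_den[OF assms(2), of a], of k] that assms(1) by auto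
    then have "cf_den a (m - 1) mod k \<noteq> 0" by (simp add: mod_eq_0_iff_dvd)
    moreover have "cf_den a (m - 1) mod k < k" using assms(1) by simp
    ultimately show ?thesis by auto
  qed
  then show ?thesis unfolding of_type_def char by (auto simp: mod_eq_0_iff_dvd)
qed

text \<open>Once k divides the denominator at some index, the next one is coprime to k. By the
  recurrence, k then divides the denominator two places on exactly when it divides the partial
  quotient there.\<close>

lemma dvd_cf_den_iff:
  assumes "k \<ge> 2" "m \<ge> - 1"
  shows "(\<forall>n::nat. k dvd cf_den a (m + 2 * int n)) \<longleftrightarrow>
    of_type k (map a [0..<nat (m + 1)]) \<and> (\<forall>n::nat\<ge>1. k dvd a (nat (m + 2 * int n)))"
proof -
  have step: "cf_den a (m + 2 * int (Suc n)) =
      a (nat (m + 2 * int (Suc n))) * cf_den a (m + 2 * int n + 1) + cf_den a (m + 2 * int n)" for n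
    using cf_den_simps(3)[of "m + 2 * int (Suc n)" a] assms(2) by (simp add: algebra_simps)
  have iff: "k dvd cf_den a (m + 2 * int (Suc n)) \<longleftrightarrow> k dvd a (nat (m + 2 * int (Suc n)))"
    if "k dvd cf_den a (m + 2 * int n)" for n
  proof -
    have "coprime (cf_den a (m + 2 * int n)) (cf_den a (m + 2 * int n + 1))"
      using coprime_cf_den[of "m + 2 * int n + 1" a] assms(2) by simp
    then have "coprime k (cf_den a (m + 2 * int n + 1))"
      by (rule coprime_divisors[OF that dvd_refl])
    then show ?thesis
      unfolding step using that by (simp only: dvd_add_left_iff coprime_dvd_mult_left_iff)
  qed
  show ?thesis
    unfolding of_type_iff[OF assms]
  proof safe
    assume all: "\<forall>n::nat. k dvd cf_den a (m + 2 * int n)"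
    then show "k dvd cf_den a m" by (metis add.right_neutral mult_zero_right of_nat_0)
    fix n :: nat assume "n \<ge> 1"
    then obtain l where "n = Suc l" by (cases n) auto
    then show "k dvd a (nat (m + 2 * int n))" using iff[of l] all by blast
  next
    assume *: "k dvd cf_den a m" "\<forall>n::nat\<ge>1. k dvd a (nat (m + 2 * int n))"
    show "k dvd cf_den a (m + 2 * int n)" for n
    proof (induction n)
      case 0
      then show ?case using *(1) by simp
    next
      case (Suc n)
      then show ?case using iff[OF Suc] *(2) by (metis Suc_le_mono le0 One_nat_def)
    qed
  qed
qed

section \<open>Convergents of \<alpha> and of - \<alpha>\<close>

lemma cf_error_sign:
  assumes "\<alpha> > 0" "\<alpha> \<notin> \<rat>" and a: "a = partial_quotient \<alpha>"
  shows "(- 1) ^ n * (real (cf_den a (int n)) * \<alpha> - real (cf_num a (int n))) > 0"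
proof -
  define l where "l m = real (cf_den a m) * \<alpha> - real (cf_num a m)" for m
  \<comment> \<open>Complete quotients of positive index are positive, so this relation makes the
    errors alternate in sign, starting from l (- 1) = - 1.\<close>
  have step: "l (int n - 1) = - complete_quotient \<alpha> (Suc n) * l (int n)" for n
    using cf_complete_quotient[OF assms(1,2), of "Suc n"] unfolding a[symmetric]
    by (simp add: l_def algebra_simps del: complete_quotient.simps)
  have pos: "complete_quotient \<alpha> (Suc n) > 0" for n
    using complete_quotient_gt_1[OF assms(2), of n] by linarith
  have "(- 1) ^ n * l (int n) > 0"
  proof (induction n)
    case 0
    have "l (- 1) = - 1" by (simp add: l_def)
    then have "complete_quotient \<alpha> (Suc 0) * l 0 = 1"
      using step[of 0] by (simp del: complete_quotient.simps)
    then have "0 < l 0" using pos[of 0] by (metis zero_less_mult_pos zero_less_one)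
    then show ?case by simp
  next
    case (Suc n)
    have "(- 1) ^ n * l (int n) = complete_quotient \<alpha> (Suc (Suc n)) * ((- 1) ^ Suc n * l (int (Suc n)))"
      using step[of "Suc n"] by (simp del: complete_quotient.simps)
    then show ?case using Suc pos[of "Suc n"] by (metis zero_less_mult_pos)
  qed
  then show ?thesis by (simp add: l_def)
qed

lemma cf_det_int:
  "int (cf_num a (int n + 1)) * int (cf_den a (int n)) - int (cf_num a (int n)) * int (cf_den a (int n + 1)) =
    (- 1) ^ n"
proof -
  have "real_of_int (int (cf_num a (int n + 1)) * int (cf_den a (int n)) -
      int (cf_num a (int n)) * int (cf_den a (int n + 1))) = real_of_int ((- 1) ^ n)"
    using cf_determinant[of a "n + 2"] by (simp add: algebra_simps)
  then show ?thesis by (simp only: of_int_eq_iff)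
qed

lemma convergent_sequence_uminus:
  assumes "\<alpha> > 0" "\<alpha> \<notin> \<rat>" and a: "a = partial_quotient \<alpha>"
  shows "convergent_sequence (- \<alpha>) (\<lambda>n. a (n + 2)) (\<lambda>n. cf_den a (int n)) (\<lambda>n. - int (cf_num a (int n)))"
proof
  show "- \<alpha> \<notin> \<rat>" using assms(2) by simp
  fix n
  show "1 \<le> a (n + 2)" using partial_quotient_ge_1[OF assms(2), of "n + 1"] by (simp add: a)
  show "1 \<le> cf_den a (int n)"
    using cf_den_ge[of a n] partial_quotient_ge_1[OF assms(2)] by (simp add: a)
  show "cf_den a (int (Suc (Suc n))) = a (n + 2) * cf_den a (int (Suc n)) + cf_den a (int n)"
    using cf_den_simps(3)[of "int n + 2" a] by (simp add: nat_add_distrib algebra_simps)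
  show "- int (cf_num a (int (Suc (Suc n)))) =
      int (a (n + 2)) * - int (cf_num a (int (Suc n))) + - int (cf_num a (int n))"
    using cf_num_simps(3)[of "int n + 2" a] by (simp add: nat_add_distrib algebra_simps)
  show "- int (cf_num a (int n)) * int (cf_den a (int (Suc n))) -
      - int (cf_num a (int (Suc n))) * int (cf_den a (int n)) = (- 1) ^ n"
    using cf_det_int[of a n] by (simp add: algebra_simps)
  show "(- 1) ^ n * (real (cf_den a (int n)) * - \<alpha> - of_int (- int (cf_num a (int n)))) < 0"
    using cf_error_sign[OF assms, of n] by (simp add: algebra_simps)
qed

text \<open>The convergents of \<alpha> lie below \<alpha> at even indices; shifting by one puts
  those above \<alpha> at the even positions, as \<open>sign\<close> requires.\<close>

lemma convergent_sequence_Suc: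
  assumes "\<alpha> > 0" "\<alpha> \<notin> \<rat>" and a: "a = partial_quotient \<alpha>"
  shows "convergent_sequence \<alpha> (\<lambda>n. a (n + 3)) (\<lambda>n. cf_den a (int n + 1)) (\<lambda>n. int (cf_num a (int n + 1)))"
proof
  show "\<alpha> \<notin> \<rat>" by fact
  fix n
  show "1 \<le> a (n + 3)" using partial_quotient_ge_1[OF assms(2), of "n + 2"] by (simp add: a eval_nat_numeral)
  show "1 \<le> cf_den a (int n + 1)"
    using cf_den_ge[of a "Suc n"] partial_quotient_ge_1[OF assms(2)] by (simp add: a add.commute)
  show "cf_den a (int (Suc (Suc n)) + 1) = a (n + 3) * cf_den a (int (Suc n) + 1) + cf_den a (int n + 1)"
    using cf_den_simps(3)[of "int n + 3" a] by (simp add: nat_add_distrib algebra_simps)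
  show "int (cf_num a (int (Suc (Suc n)) + 1)) =
      int (a (n + 3)) * int (cf_num a (int (Suc n) + 1)) + int (cf_num a (int n + 1))"
    using cf_num_simps(3)[of "int n + 3" a] by (simp add: nat_add_distrib algebra_simps)
  show "int (cf_num a (int n + 1)) * int (cf_den a (int (Suc n) + 1)) -
      int (cf_num a (int (Suc n) + 1)) * int (cf_den a (int n + 1)) = (- 1) ^ n"
    using cf_det_int[of a "Suc n"] by (simp add: algebra_simps)
  show "(- 1) ^ n * (real (cf_den a (int n + 1)) * \<alpha> - of_int (int (cf_num a (int n + 1)))) < 0"
    using cf_error_sign[OF assms, of "Suc n"] by (simp add: algebra_simps)
qed

text \<open>Negation reflects [0, 1 - c) to the part of the unit interval above c, and no orbit
  point hits the common endpoint c.\<close>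

lemma discrepancy_uminus:
  assumes "\<alpha> \<notin> \<rat>" "c \<in> \<rat>"
  shows "discrepancy n (- \<alpha>) (1 - c) = - discrepancy n \<alpha> c"
proof -
  have "indicat_real {0..<1 - c} (frac (real j * - \<alpha>)) = 1 - indicat_real {0..<c} (frac (real j * \<alpha>))"
    if "j \<in> {1..n}" for j
  proof -
    have irr: "real j * \<alpha> \<notin> \<rat>"
    proof
      assume "real j * \<alpha> \<in> \<rat>"
      then have "real j * \<alpha> / real j \<in> \<rat>" by (intro Rats_divide) auto
      then show False using assms(1) that by simp
    qed
    then have "frac (real j * \<alpha>) \<noteq> c" using assms(2) by (metis frac_in_Rats_iff)
    moreover have "frac (real j * - \<alpha>) = 1 - frac (real j * \<alpha>)"
      using irr Ints_subset_Rats by (auto simp: frac_neg)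
    ultimately show ?thesis by (auto simp: indicator_def less_imp_le[OF frac_lt_1])
  qed
  then have "(\<Sum>j = 1..n. indicat_real {0..<1 - c} (frac (real j * - \<alpha>))) =
    (\<Sum>j = 1..n. 1 - indicat_real {0..<c} (frac (real j * \<alpha>)))"
    by (intro sum.cong) auto
  then show ?thesis unfolding discrepancy_def by (simp add: sum_subtractf algebra_simps)
qed

theorem theorem1p2:
  fixes \<alpha> c :: real and h k :: nat and a :: "nat \<Rightarrow> nat" and q :: "int \<Rightarrow> nat"
  assumes "\<alpha> > 0" and "\<alpha> \<notin> \<rat>"
    and "h > 0" and "k > 0" and "coprime h k"
    and "c = real h / real k" and "0 < c" and "c < 1"
    and "a = partial_quotient \<alpha>" and "q = cf_den a"
  shows
    "((SUP n. ereal (discrepancy n \<alpha> c)) < \<infinity>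
        \<longleftrightarrow> (\<exists>m::int. m \<ge> - 1 \<and> even m \<and> (\<forall>n::nat. k dvd q (m + 2 * int n))))
      \<and> ((\<exists>m::int. m \<ge> - 1 \<and> even m \<and> (\<forall>n::nat. k dvd q (m + 2 * int n)))
        \<longleftrightarrow> (\<exists>m::int. m \<ge> - 1 \<and> even m \<and> of_type k (map a [0..<nat (m + 1)])
               \<and> (\<forall>n::nat\<ge>1. k dvd a (nat (m + 2 * int n)))))
      \<and> ((INF n. ereal (discrepancy n \<alpha> c)) > - \<infinity>
        \<longleftrightarrow> (\<exists>m::int. m \<ge> - 1 \<and> odd m \<and> (\<forall>n::nat. k dvd q (m + 2 * int n))))
      \<and> ((\<exists>m::int. m \<ge> - 1 \<and> odd m \<and> (\<forall>n::nat. k dvd q (m + 2 * int n)))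
        \<longleftrightarrow> (\<exists>m::int. m \<ge> - 1 \<and> odd m \<and> of_type k (map a [0..<nat (m + 1)])
               \<and> (\<forall>n::nat\<ge>1. k dvd a (nat (m + 2 * int n)))))"
proof -
  have hk: "h < k" using assms(4,6,8) by simp
  then have k2: "k \<ge> 2" using assms(3) by linarith
  \<comment> \<open>\<open>pos\<close> turns lower boundedness for \<alpha> into divisibility at odd
    indices. \<open>neg\<close>, for - \<alpha> and 1 - c, turns upper boundedness into divisibility
    at even indices.\<close>
  interpret pos: rational_interval \<alpha> "\<lambda>n. a (n + 3)" "\<lambda>n. cf_den a (int n + 1)"
      "\<lambda>n. int (cf_num a (int n + 1))" h k c
    using convergent_sequence_Suc[OF assms(1,2,9)] hk assms
    by (simp add: rational_interval_def rational_interval_axioms_def)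
  interpret neg: rational_interval "- \<alpha>" "\<lambda>n. a (n + 2)" "\<lambda>n. cf_den a (int n)"
      "\<lambda>n. - int (cf_num a (int n))" "k - h" k "1 - c"
  proof -
    have "coprime (k - h) k"
    proof (rule coprimeI)
      fix x assume x: "x dvd k - h" "x dvd k"
      then have "x dvd (k - h) + h" using hk by simp
      then have "x dvd h" using x(1) by (simp only: dvd_add_right_iff)
      then show "is_unit x" using x(2) assms(5) by (intro coprime_common_divisor)
    qed
    moreover have "1 - c = real (k - h) / real k" using hk assms(6) by (simp add: of_nat_diff field_simps)
    ultimately show "rational_interval (- \<alpha>) (\<lambda>n. a (n + 2)) (\<lambda>n. cf_den a (int n))
        (\<lambda>n. - int (cf_num a (int n))) (k - h) k (1 - c)"
      using convergent_sequence_uminus[OF assms(1,2,9)] hk assms(3)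
      by (simp add: rational_interval_def rational_interval_axioms_def)
  qed
  have "c \<in> \<rat>" by (simp add: assms(6))
  have "(SUP n. ereal (discrepancy n \<alpha> c)) < \<infinity> \<longleftrightarrow> (\<exists>C. \<forall>n. discrepancy n \<alpha> c \<le> C)"
    by (rule SUP_ereal_less_infinity_iff)
  also have "\<dots> \<longleftrightarrow> (\<exists>C. \<forall>n. discrepancy n (- \<alpha>) (1 - c) \<ge> C)"
    unfolding discrepancy_uminus[OF assms(2) \<open>c \<in> \<rat>\<close>] using bounded_above_uminus_iff[of "\<lambda>n. - discrepancy n \<alpha> c"] by simp
  also have "\<dots> \<longleftrightarrow> (\<exists>m. \<forall>n\<ge>m. k dvd q (int (2 * n)))"
    unfolding neg.bounded_below_iff assms(10) ..
  also have "\<dots> \<longleftrightarrow> (\<exists>m::int. m \<ge> - 1 \<and> even m \<and> (\<forall>n::nat. k dvd q (m + 2 * int n)))"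
  proof safe
    fix m assume m: "\<forall>n\<ge>m. k dvd q (int (2 * n))"
    have "k dvd q (2 * int m + 2 * int n)" for n
      using m[rule_format, of "m + n"] by (simp add: algebra_simps)
    then show "\<exists>m::int. m \<ge> - 1 \<and> even m \<and> (\<forall>n::nat. k dvd q (m + 2 * int n))"
      by (intro exI[of _ "2 * int m"]) auto
  next
    fix m :: int assume m: "m \<ge> - 1" "even m" "\<forall>n::nat. k dvd q (m + 2 * int n)"
    then obtain l where l: "m = 2 * l" by blast
    have "l \<ge> 0" using m(1) l by linarith
    have "k dvd q (int (2 * n))" if "n \<ge> nat l" for n
      using m(3)[rule_format, of "n - nat l"] that l \<open>l \<ge> 0\<close> by (simp add: of_nat_diff)
    then show "\<exists>m. \<forall>n\<ge>m. k dvd q (int (2 * n))" by blast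
  qed
  finally have sup: "(SUP n. ereal (discrepancy n \<alpha> c)) < \<infinity>
    \<longleftrightarrow> (\<exists>m::int. m \<ge> - 1 \<and> even m \<and> (\<forall>n::nat. k dvd q (m + 2 * int n)))" .
  have "(INF n. ereal (discrepancy n \<alpha> c)) > - \<infinity> \<longleftrightarrow> (\<exists>C. \<forall>n. discrepancy n \<alpha> c \<ge> C)"
    by (rule INF_ereal_greater_minus_infinity_iff)
  also have "\<dots> \<longleftrightarrow> (\<exists>m. \<forall>n\<ge>m. k dvd q (int (2 * n) + 1))"
    unfolding pos.bounded_below_iff assms(10) ..
  also have "\<dots> \<longleftrightarrow> (\<exists>m::int. m \<ge> - 1 \<and> odd m \<and> (\<forall>n::nat. k dvd q (m + 2 * int n)))"
  proof safe
    fix m assume m: "\<forall>n\<ge>m. k dvd q (int (2 * n) + 1)"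
    have "k dvd q (2 * int m + 1 + 2 * int n)" for n
      using m[rule_format, of "m + n"] by (simp add: algebra_simps)
    then show "\<exists>m::int. m \<ge> - 1 \<and> odd m \<and> (\<forall>n::nat. k dvd q (m + 2 * int n))"
      by (intro exI[of _ "2 * int m + 1"]) auto
  next
    fix m :: int assume m: "m \<ge> - 1" "odd m" "\<forall>n::nat. k dvd q (m + 2 * int n)"
    then obtain l where l: "m = 2 * l + 1" by (elim oddE)
    \<comment> \<open>The value l = - 1 is the case m = - 1 of the empty tuple, hence the shift to
      \<open>nat (l + 1)\<close>.\<close>
    have "l \<ge> - 1" using m(1) l by linarith
    have "k dvd q (int (2 * n) + 1)" if "n \<ge> nat (l + 1)" for n
      using m(3)[rule_format, of "n + 1 - nat (l + 1)"] that l \<open>l \<ge> - 1\<close>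
      by (simp add: of_nat_diff algebra_simps)
    then show "\<exists>m. \<forall>n\<ge>m. k dvd q (int (2 * n) + 1)" by blast
  qed
  finally have inf: "(INF n. ereal (discrepancy n \<alpha> c)) > - \<infinity>
    \<longleftrightarrow> (\<exists>m::int. m \<ge> - 1 \<and> odd m \<and> (\<forall>n::nat. k dvd q (m + 2 * int n)))" .
  show ?thesis
    using sup inf dvd_cf_den_iff[OF k2, where a = a] unfolding assms(10) by blast
qed

end
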